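(* Let $K_1$ be the multi-virtual knot represented by the three-crossing trefoil diagram with one classical crossing, one virtual crossing of type $\alpha_1$ and one virtual crossing of type $\alpha_2$ described in the context, and let $M(K_1)$ be the multi-virtual knot obtained by replacing the classical crossing with a virtual crossing of type $\alpha_0$. Then $M(K_1)$ is a multi-virtual trefoil knot with three virtual crossings of distinct types, and its intersection numbers are $I_{01}=I_{12}=-1$ and $I_{02}=1$. Thus $M(K_1)$ is nontrivial. This provides a negative answer to Problem 3.2 of the 2026 paper of Kauffman, Mukherjee and Vojtěchovský on multi-virtual knots.
   Context: Multi-virtual knots. A multi-virtual knot diagram is an oriented knot diagram in the plane in which each double point is either a classical crossing (with over/under information) or a virtual crossing labelled by a type from a finite set of types; here the types are $\alpha_0,\alpha_1,\alpha_2$. Two diagrams are equivalent if they are related by planar isotopy, the classical Reidemeister moves $\Omega_1,\Omega_2,\Omega_3$ and the multi-virtual Reidemeister moves: $\Omega_1^v$ (add/remove a kink whose crossing is virtual); $\Omega_2^v$ (add/remove a bigon whose two crossings are virtual of the same type); $\Omega_3^v$ (a strand having virtual crossings of the same type $\alpha_i$ with two other strands is slid across a virtual crossing of type $\alpha_j$ of those two strands, $i=j$ allowed); $\Omega_3^{cv}$ (a strand having virtual crossings of the same type with two other strands is slid across a classical crossing of those two strands). A multi-virtual knot is an equivalence class of diagrams; it is trivial if it has a diagram with no crossings. The map $M$. For a multi-virtual knot $K$ with diagram $D$ whose virtual crossings have types in $\{\alpha_1,\dots,\alpha_k\}$, $M(D)$ is the diagram obtained from $D$ by replacing all classical crossings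 with virtual crossings of the additional type $\alpha_0$. The multi-virtual knot represented by $M(D)$ does not depend on the choice of $D$ and is denoted $M(K)$. Intersection numbers. The Gauss diagram of $D$ is an anticlockwise oriented plane circle with one oriented chord for each crossing, joining the two preimages of that crossing. A chord of a classical crossing is directed from the preimage of the overcrossing to the preimage of the undercrossing; a chord of a virtual crossing (a virtual chord) carries the type of the crossing and the direction it would get if the virtual crossing were replaced by a positive classical crossing. For types $\alpha_i,\alpha_j$, let $V_i\cap V_j$ be the set of intersection points between virtual chords of type $\alpha_i$ and virtual chords of type $\alpha_j$. For $p\in V_i\cap V_j$ set $w(p)=+1$ if the orientation induced at $p$ by the type $\alpha_i$ chord and the type $\alpha_j$ chord (in this order) coincides with the canonical orientation of the plane, and $w(p)=-1$ otherwise. The intersection number is $I_{ij}=\sum_{p\in V_i\cap V_j}w(p)$; for $i<j$ it is an invariant of multi-virtual knots. The knot $K_1$. Take the standard three-crossing trefoil diagram, the closure of the 2-braid $(\sigma_1)^3$ with both strands oriented in parallel. Keep one crossing as a positive classical crossing, and replace the other two by virtual crossings of types $\alpha_1$ and $\alpha_2$, so that, travelling along the knot in the direction of its orientation, the crossings are met in the cyclic order: classical, $\alpha_1$, $\alpha_2$. *)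

theory Defs
  imports "HOL-Analysis.Analysis"
begin

section \<open>Multi-virtual knot diagrams\<close>

text \<open>The plane is the type of complex numbers and the virtual type \<open>\<alpha>\<^sub>i\<close> is the natural
  number \<open>i\<close>. An oriented knot diagram is a generic closed \<open>C\<^sup>1\<close> immersion, given by a
  1-periodic function on the real line. The crossing data are attached to the preimages of the
  double points: the two preimages of a classical crossing are marked \<open>Over\<close> and \<open>Under\<close>, and
  both preimages of a virtual crossing of type \<open>i\<close> are marked \<open>Virt i\<close>. Marks of all other
  parameters are meaningless (and are ignored by the equivalence below).\<close>

datatype mark = Over | Under | Virt nat

record diagram =
  curve :: "real \<Rightarrow> complex"
  mark :: "real \<Rightarrow> mark"

definition velocity :: "diagram \<Rightarrow> real \<Rightarrow> complex" where
  "velocity D t = vector_derivative (curve D) (at t)"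

text \<open>The determinant of the pair \<open>(v, w)\<close> of plane vectors.\<close>

definition cross2 :: "complex \<Rightarrow> complex \<Rightarrow> real" where
  "cross2 v w = Re v * Im w - Im v * Re w"

definition double_param :: "diagram \<Rightarrow> real \<Rightarrow> bool" where
  "double_param D t \<longleftrightarrow> (\<exists>s. s - t \<notin> \<int> \<and> curve D s = curve D t)"

definition crossing_points :: "diagram \<Rightarrow> complex set" where
  "crossing_points D = curve D ` {t. double_param D t}"

definition classical_marks :: "mark \<Rightarrow> mark \<Rightarrow> bool" where
  "classical_marks \<mu> \<nu> \<longleftrightarrow> (\<mu> = Over \<and> \<nu> = Under) \<or> (\<mu> = Under \<and> \<nu> = Over)"

definition virtual_marks :: "mark \<Rightarrow> mark \<Rightarrow> bool" where
  "virtual_marks \<mu> \<nu> \<longleftrightarrow> (\<exists>i. \<mu> = Virt i \<and> \<nu> = Virt i)"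

definition crossing_marks :: "mark \<Rightarrow> mark \<Rightarrow> bool" where
  "crossing_marks \<mu> \<nu> \<longleftrightarrow> classical_marks \<mu> \<nu> \<or> virtual_marks \<mu> \<nu>"

definition mv_diagram :: "nat set \<Rightarrow> diagram \<Rightarrow> bool" where
  "mv_diagram T D \<longleftrightarrow>
     (\<forall>t. curve D (t + 1) = curve D t \<and> mark D (t + 1) = mark D t) \<and>
     curve D C1_differentiable_on UNIV \<and>
     (\<forall>t. velocity D t \<noteq> 0) \<and>
     finite (crossing_points D) \<and>
     (\<forall>s t. s - t \<notin> \<int> \<and> curve D s = curve D t \<longrightarrow>
        cross2 (velocity D s) (velocity D t) \<noteq> 0 \<and>
        crossing_marks (mark D s) (mark D t) \<and>
        (\<forall>i. mark D s = Virt i \<longrightarrow> i \<in> T)) \<and>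
     (\<forall>s t u. s - t \<notin> \<int> \<and> t - u \<notin> \<int> \<and> s - u \<notin> \<int> \<longrightarrow>
        \<not> (curve D s = curve D t \<and> curve D t = curve D u))"


section \<open>Planar isotopy\<close>

definition ambient_isotopy :: "(real \<Rightarrow> complex \<Rightarrow> complex) \<Rightarrow> bool" where
  "ambient_isotopy H \<longleftrightarrow>
     H 0 = id \<and>
     (\<forall>u\<in>{0..1}. bij (H u)) \<and>
     continuous_on ({0..1} \<times> UNIV) (\<lambda>(u, z). H u z) \<and>
     (\<exists>H' :: real \<Rightarrow> complex \<Rightarrow> (complex \<Rightarrow>\<^sub>L complex).
        (\<forall>u\<in>{0..1}. \<forall>z. (H u has_derivative blinfun_apply (H' u z)) (at z) \<and>
                       inj (blinfun_apply (H' u z))) \<and>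
        continuous_on ({0..1} \<times> UNIV) (\<lambda>(u, z). H' u z))"

text \<open>Orientation-preserving reparametrizations of the circle, lifted to the real line.\<close>

definition reparametrization :: "(real \<Rightarrow> real) \<Rightarrow> bool" where
  "reparametrization \<phi> \<longleftrightarrow>
     \<phi> C1_differentiable_on UNIV \<and> (\<forall>t. 0 < deriv \<phi> t) \<and> (\<forall>t. \<phi> (t + 1) = \<phi> t + 1)"

definition planar_isotopic :: "diagram \<Rightarrow> diagram \<Rightarrow> bool" where
  "planar_isotopic D D' \<longleftrightarrow>
     (\<exists>H \<phi>. ambient_isotopy H \<and> reparametrization \<phi> \<and>
        (\<forall>t. curve D' (\<phi> t) = H 1 (curve D t)) \<and>
        (\<forall>t. double_param D t \<longrightarrow> mark D' (\<phi> t) = mark D t))"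


section \<open>Multi-virtual Reidemeister moves\<close>

text \<open>A move replaces the part of a diagram inside the square with corners \<open>\<plusminus>1 \<plusminus> \<i>\<close>. Inside the
  square the diagram consists of strands given by explicit functions on \<open>{-1..1}\<close>; the
  \<open>k\<close>-th strand is traversed for parameters within distance \<open>r\<close> of \<open>c k\<close> (modulo 1), in the
  direction \<open>e k = \<plusminus>1\<close>. A disc in any other position, or a different shape or speed of the
  strands, is reduced to this normal form by planar isotopy.\<close>

definition move_square :: "complex set" where
  "move_square = {z. \<bar>Re z\<bar> \<le> 1 \<and> \<bar>Im z\<bar> \<le> 1}"

definition strand_layout ::
    "nat \<Rightarrow> (nat \<Rightarrow> real) \<Rightarrow> (nat \<Rightarrow> real) \<Rightarrow> real \<Rightarrow> bool" where
  "strand_layout n c e r \<longleftrightarrow>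
     0 < r \<and> (\<forall>k<n. e k = 1 \<or> e k = -1) \<and>
     (\<forall>k<n. \<forall>l<n. \<forall>m::int. k \<noteq> l \<or> m \<noteq> 0 \<longrightarrow> 2 * r < \<bar>c k - c l - of_int m\<bar>)"

definition inner_param :: "nat \<Rightarrow> (nat \<Rightarrow> real) \<Rightarrow> real \<Rightarrow> real \<Rightarrow> bool" where
  "inner_param n c r t \<longleftrightarrow> (\<exists>k<n. \<exists>m::int. \<bar>t - c k - of_int m\<bar> \<le> r)"

definition has_tangle ::
    "(real \<Rightarrow> complex) list \<Rightarrow> (nat \<Rightarrow> real) \<Rightarrow> (nat \<Rightarrow> real) \<Rightarrow> real \<Rightarrow> diagram \<Rightarrow> bool" where
  "has_tangle F c e r D \<longleftrightarrow>
     (\<forall>t. curve D t \<in> move_square \<longleftrightarrow> inner_param (length F) c r t) \<and>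
     (\<forall>k<length F. \<forall>x\<in>{-1..1}. curve D (c k + e k * r * x) = (F ! k) x)"

definition local_move ::
    "(real \<Rightarrow> complex) list \<Rightarrow> (real \<Rightarrow> complex) list \<Rightarrow>
     (nat \<Rightarrow> real) \<Rightarrow> (nat \<Rightarrow> real) \<Rightarrow> real \<Rightarrow> diagram \<Rightarrow> diagram \<Rightarrow> bool" where
  "local_move F F' c e r D D' \<longleftrightarrow>
     length F' = length F \<and> strand_layout (length F) c e r \<and>
     has_tangle F c e r D \<and> has_tangle F' c e r D' \<and>
     (\<forall>t. \<not> inner_param (length F) c r t \<longrightarrow> curve D' t = curve D t \<and> mark D' t = mark D t)"

definition bump :: "real \<Rightarrow> real" where
  "bump x = (1 - x\<^sup>2)\<^sup>2"

text \<open>The moves \<open>\<Omega>\<^sub>1\<close> and \<open>\<Omega>\<^sub>1\<^sup>v\<close>. The self-crossing of the kink is at \<open>x = \<plusminus>1 / sqrt 2\<close>.\<close>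

definition kink :: "real \<Rightarrow> complex" where
  "kink x = Complex (x * (1 - 4 * bump x)) (bump x / 2)"

definition omega1 :: "diagram \<Rightarrow> diagram \<Rightarrow> bool" where
  "omega1 D D' \<longleftrightarrow>
     (\<exists>c e r \<mu> \<nu>. local_move [\<lambda>x. Complex x 0] [kink] c e r D D' \<and>
        crossing_marks \<mu> \<nu> \<and>
        (\<forall>x\<in>{-1..1}. mark D' (c 0 + e 0 * r * x) = (if x < 0 then \<mu> else \<nu>)))"

text \<open>The moves \<open>\<Omega>\<^sub>2\<close> and \<open>\<Omega>\<^sub>2\<^sup>v\<close>: either one strand passes over the other at both
  crossings, or both crossings are virtual of the same type.\<close>

definition omega2 :: "diagram \<Rightarrow> diagram \<Rightarrow> bool" where
  "omega2 D D' \<longleftrightarrow>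
     (\<exists>c e r \<mu> \<nu>. local_move
          [\<lambda>x. Complex x 0, \<lambda>x. Complex x (1 / 2)]
          [\<lambda>x. Complex x 0, \<lambda>x. Complex x (1 / 2 - bump x)] c e r D D' \<and>
        crossing_marks \<mu> \<nu> \<and>
        (\<forall>x\<in>{-1..1}. mark D' (c 0 + e 0 * r * x) = \<mu> \<and> mark D' (c 1 + e 1 * r * x) = \<nu>))"

text \<open>Strand 0 is slid across the crossing of strands 1 and 2, which is at the origin
  (\<open>x = 0\<close>). The marks \<open>\<mu>\<close> and \<open>\<nu>\<close> belong to the crossings of strand 0, on strand 0 and on the
  other strands respectively; \<open>\<kappa>\<close> and \<open>\<kappa>'\<close> belong to the crossing of strands 1 and 2.\<close>

definition slide :: "mark \<Rightarrow> mark \<Rightarrow> mark \<Rightarrow> mark \<Rightarrow> diagram \<Rightarrow> diagram \<Rightarrow> bool" where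
  "slide \<mu> \<nu> \<kappa> \<kappa>' D D' \<longleftrightarrow>
     (\<exists>c e r. local_move
          [\<lambda>x. Complex x (bump x / 2), \<lambda>x. Complex x (x / 2), \<lambda>x. Complex x (- x / 2)]
          [\<lambda>x. Complex x (- bump x / 2), \<lambda>x. Complex x (x / 2), \<lambda>x. Complex x (- x / 2)]
          c e r D D' \<and>
        (\<forall>E\<in>{D, D'}. \<forall>x\<in>{-1..1}.
           mark E (c 0 + e 0 * r * x) = \<mu> \<and>
           mark E (c 1 + e 1 * r * x) = (if x = 0 then \<kappa> else \<nu>) \<and>
           mark E (c 2 + e 2 * r * x) = (if x = 0 then \<kappa>' else \<nu>)))"

text \<open>In a classical third move one of the three strands is above the other two, and the move
  can be seen as sliding that strand.\<close>

definition omega3 :: "diagram \<Rightarrow> diagram \<Rightarrow> bool" where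
  "omega3 D D' \<longleftrightarrow> (\<exists>\<kappa> \<kappa>'. classical_marks \<kappa> \<kappa>' \<and> slide Over Under \<kappa> \<kappa>' D D')"

definition omega3_v :: "diagram \<Rightarrow> diagram \<Rightarrow> bool" where
  "omega3_v D D' \<longleftrightarrow> (\<exists>i j. slide (Virt i) (Virt i) (Virt j) (Virt j) D D')"

definition omega3_cv :: "diagram \<Rightarrow> diagram \<Rightarrow> bool" where
  "omega3_cv D D' \<longleftrightarrow>
     (\<exists>i \<kappa> \<kappa>'. classical_marks \<kappa> \<kappa>' \<and> slide (Virt i) (Virt i) \<kappa> \<kappa>' D D')"


section \<open>Multi-virtual knots\<close>

definition mv_step :: "nat set \<Rightarrow> diagram \<Rightarrow> diagram \<Rightarrow> bool" where
  "mv_step T D D' \<longleftrightarrow> mv_diagram T D \<and> mv_diagram T D' \<and>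
     (planar_isotopic D D' \<or> omega1 D D' \<or> omega2 D D' \<or>
      omega3 D D' \<or> omega3_v D D' \<or> omega3_cv D D')"

definition mv_equivalent :: "nat set \<Rightarrow> diagram \<Rightarrow> diagram \<Rightarrow> bool" where
  "mv_equivalent T = equivclp (mv_step T)"

definition mv_class :: "nat set \<Rightarrow> diagram \<Rightarrow> diagram set" where
  "mv_class T D = {D'. mv_diagram T D' \<and> mv_equivalent T D D'}"

definition mv_knots :: "nat set \<Rightarrow> diagram set set" where
  "mv_knots T = mv_class T ` {D. mv_diagram T D}"

definition trivial_knot :: "diagram set \<Rightarrow> bool" where
  "trivial_knot K \<longleftrightarrow> (\<exists>D\<in>K. crossing_points D = {})"


section \<open>The map M\<close>

definition M_diagram :: "diagram \<Rightarrow> diagram" where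
  "M_diagram D = D\<lparr>mark := \<lambda>t. case mark D t of Virt i \<Rightarrow> Virt i | _ \<Rightarrow> Virt 0\<rparr>"

text \<open>Meant for knots with virtual types in a set \<open>T\<close> not containing the additional type 0.
  The union makes the definition independent of choices; that it is a single equivalence
  class amounts to the independence of \<open>M(K)\<close> from the diagram of \<open>K\<close>.\<close>

definition M_knot :: "nat set \<Rightarrow> diagram set \<Rightarrow> diagram set" where
  "M_knot T K = (\<Union>D\<in>K. mv_class (insert 0 T) (M_diagram D))"


section \<open>Intersection numbers\<close>

text \<open>The virtual chords of type \<open>i\<close> of the Gauss diagram, as pairs (tail, head) of parameters.
  If a virtual crossing is replaced by a positive classical crossing, the over strand
  is the one whose velocity, followed by that of the under strand, is a positive frame.\<close>

definition virtual_chords :: "diagram \<Rightarrow> nat \<Rightarrow> (real \<times> real) set" where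
  "virtual_chords D i =
     {(s, t). s \<in> {0..<1} \<and> t \<in> {0..<1} \<and> s \<noteq> t \<and> curve D s = curve D t \<and>
              mark D s = Virt i \<and> mark D t = Virt i \<and>
              0 < cross2 (velocity D s) (velocity D t)}"

definition circle_point :: "real \<Rightarrow> complex" where
  "circle_point t = cis (2 * pi * t)"

definition chord_segment :: "real \<times> real \<Rightarrow> complex set" where
  "chord_segment p = closed_segment (circle_point (fst p)) (circle_point (snd p))"

definition chord_vector :: "real \<times> real \<Rightarrow> complex" where
  "chord_vector p = circle_point (snd p) - circle_point (fst p)"

definition chord_sign :: "real \<times> real \<Rightarrow> real \<times> real \<Rightarrow> int" where
  "chord_sign p q = (if 0 < cross2 (chord_vector p) (chord_vector q) then 1 else -1)"

definition intersection_number :: "nat \<Rightarrow> nat \<Rightarrow> diagram \<Rightarrow> int" where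
  "intersection_number i j D =
     (\<Sum>(p, q) | p \<in> virtual_chords D i \<and> q \<in> virtual_chords D j \<and>
               chord_segment p \<inter> chord_segment q \<noteq> {}. chord_sign p q)"


section \<open>The knot \<open>K\<^sub>1\<close>\<close>

text \<open>The curve winds twice anticlockwise around the origin, at distance \<open>2 + cos (6 \<pi> t)\<close>, as
  the closure of the 2-braid with three crossings. Its double points have the
  preimages \<open>{1/12, 7/12}\<close>, \<open>{3/12, 9/12}\<close> and \<open>{5/12, 11/12}\<close>, and are thus met in this cyclic order.
  They get a classical crossing, type 1 and type 2 respectively. The classical crossing is
  positive: at \<open>7/12\<close> the curve moves outwards, at \<open>1/12\<close> inwards, and both
  strands turn anticlockwise around the origin, so the frame (velocity at \<open>7/12\<close>, velocity at
  \<open>1/12\<close>) is positive.\<close>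

definition trefoil_curve :: "real \<Rightarrow> complex" where
  "trefoil_curve t = of_real (2 + cos (6 * pi * t)) * cis (4 * pi * t)"

definition K1_diagram :: diagram where
  "K1_diagram =
     \<lparr>curve = trefoil_curve,
      mark = \<lambda>t. if frac t = 7 / 12 then Over
                 else if frac t = 1 / 12 then Under
                 else if frac t = 3 / 12 \<or> frac t = 9 / 12 then Virt 1
                 else Virt 2\<rparr>"

definition K1 :: "diagram set" where
  "K1 = mv_class {1, 2} K1_diagram"

end

theory Submission
  imports Defs
begin

text \<open>For a type \<open>i\<close> let \<open>f\<^sub>i\<close> be the function on the circle of parameters that is 1 at the tails and -1
  at the heads of the virtual chords of type \<open>i\<close>. Two chords meet iff their ends interlace, and this
  can be read off from the cyclic order of the ends; as a result the intersection number of types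
  \<open>i\<close> and \<open>j\<close> is the bilinear expression obtained by summing \<open>f\<^sub>j\<close> times a primitive of \<open>f\<^sub>i\<close>, which is
  antisymmetric because the chord ends cancel in pairs. A planar isotopy preserves orientation, hence
  chord directions and the cyclic order. A local move changes only one of the functions
  \<open>f\<^sub>i\<close>, and only on short arcs. In the first two moves the changes have sum 0 on
  each arc, where the primitive of the other function is constant. In the third move the ends at the
  two outer strands pass the two ends of the chord of the crossing of these strands, and the
  two resulting changes cancel. Hence the intersection numbers are invariants, and they are nonzero
  for the trefoil.\<close>

section \<open>Integer-valued chains on the circle\<close>

text \<open>Comparing the chords before and after a move would call for a bijection between
  crossings that appear, vanish or slide. The functions \<open>end_sign D i\<close> avoid this: two
  diagrams are compared parameter by parameter, and a chord enters only through the values at its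
  two ends. What the cut of the circle at 0 contributes to \<open>primitive\<close> is a constant,
  killed by the vanishing sum of the other chain. The restriction to distinct types makes the
  supports disjoint, so ties in the order of the ends never arise. Every crossing that a move
  creates, removes or displaces lies on one moving strand; hence all these crossings share one type
  if they are virtual, and the pairing has to be examined in one argument only.\<close>

definition circle_chain :: "(real \<Rightarrow> int) \<Rightarrow> bool" where
  "circle_chain f \<longleftrightarrow> (\<forall>t. f (t + 1) = f t) \<and> finite {t \<in> {0..<1}. f t \<noteq> 0}"

text \<open>\<open>sum'\<close> adds up over the support, so no finite index set has to be carried
  along. The half-open interval contains each point of the circle once.\<close>

definition circle_sum :: "(real \<Rightarrow> int) \<Rightarrow> int" where
  "circle_sum f = sum' f {0..<1}"

text \<open>The signed sum of \<open>g\<close> from 0 to \<open>x\<close>, as an integral; periodic if \<open>g\<close> has sum 0.\<close>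

definition primitive :: "(real \<Rightarrow> int) \<Rightarrow> real \<Rightarrow> int" where
  "primitive g x = sum' g {0..<x} - sum' g {x..<0}"

text \<open>For chains of sum 0 with disjoint supports this is a linking number of 0-cycles in the
  circle: \<open>primitive g\<close> is a 1-chain with boundary g, evaluated at the points of
  f.\<close>

definition pairing :: "(real \<Rightarrow> int) \<Rightarrow> (real \<Rightarrow> int) \<Rightarrow> int" where
  "pairing f g = circle_sum (\<lambda>x. f x * primitive g x)"

lemma sum'_eq_sum:
  assumes "finite S" "S \<subseteq> A" "\<And>x. x \<in> A - S \<Longrightarrow> f x = 0"
  shows "sum' f A = sum f S"
proof -
  have "sum' f A = sum' f S" by (rule sum.mono_neutral_right') (use assms in auto)
  then show ?thesis using assms(1) by simp
qed

lemma sum'_Un_disjoint: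
  fixes f :: "'a \<Rightarrow> int"
  assumes "finite {x \<in> A. f x \<noteq> 0}" "finite {x \<in> B. f x \<noteq> 0}" "A \<inter> B = {}"
  shows "sum' f (A \<union> B) = sum' f A + sum' f B"
proof -
  let ?A = "{x \<in> A. f x \<noteq> 0}" and ?B = "{x \<in> B. f x \<noteq> 0}"
  have "sum' f (A \<union> B) = sum f (?A \<union> ?B)" "sum' f A = sum f ?A" "sum' f B = sum f ?B"
    by (rule sum'_eq_sum; use assms in auto)+
  moreover have "sum f (?A \<union> ?B) = sum f ?A + sum f ?B"
    by (rule sum.union_disjoint) (use assms in auto)
  ultimately show ?thesis by simp
qed

lemma sum'_UN_disjoint:
  fixes f :: "'a \<Rightarrow> int"
  assumes "\<And>k. k < (n::nat) \<Longrightarrow> finite {x \<in> A k. f x \<noteq> 0}"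
    and "\<And>k l. k < n \<Longrightarrow> l < n \<Longrightarrow> k \<noteq> l \<Longrightarrow> A k \<inter> A l = {}"
  shows "sum' f (\<Union>k<n. A k) = (\<Sum>k<n. sum' f (A k))"
  using assms
proof (induction n)
  case (Suc n)
  have fin: "finite {x \<in> (\<Union>k<n. A k). f x \<noteq> 0}"
  proof (rule finite_subset)
    show "{x \<in> (\<Union>k<n. A k). f x \<noteq> 0} \<subseteq> (\<Union>k<n. {x \<in> A k. f x \<noteq> 0})" by auto
    show "finite (\<Union>k<n. {x \<in> A k. f x \<noteq> 0})" using Suc.prems(1) by auto
  qed
  have eq: "(\<Union>k<Suc n. A k) = (\<Union>k<n. A k) \<union> A n"
    by (auto simp: less_Suc_eq)
  have dis: "(\<Union>k<n. A k) \<inter> A n = {}"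
  proof -
    have "A k \<inter> A n = {}" if "k < n" for k using Suc.prems(2)[of k n] that by simp
    then show ?thesis by blast
  qed
  have "sum' f (\<Union>k<Suc n. A k) = sum' f (\<Union>k<n. A k) + sum' f (A n)"
    unfolding eq using fin Suc.prems(1)[of n] dis by (intro sum'_Un_disjoint) auto
  also have "sum' f (\<Union>k<n. A k) = (\<Sum>k<n. sum' f (A k))"
    by (rule Suc.IH) (use Suc.prems in auto)
  finally show ?case by simp
qed simp

lemma circle_chain_add_int: "circle_chain f \<Longrightarrow> f (t + of_int m) = f t"
proof (induction m rule: int_induct[where k = 0])
  case (step1 i)
  then show ?case unfolding circle_chain_def by (metis add.assoc of_int_1 of_int_add)
next
  case (step2 i)
  then have "f (t + of_int (i - 1) + 1) = f (t + of_int (i - 1))"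
    unfolding circle_chain_def by blast
  then show ?case using step2 by (simp add: algebra_simps)
qed simp

lemma circle_chain_cong_Ints:
  assumes "circle_chain f" "s - t \<in> \<int>"
  shows "f s = f t"
proof -
  from assms(2) obtain m where "s - t = of_int m" by (auto elim: Ints_cases)
  then have "s = t + of_int m" by simp
  then show ?thesis using circle_chain_add_int[OF assms(1)] by simp
qed

lemma minus_frac_in_Ints: "t - frac t \<in> \<int>" "frac t - t \<in> \<int>"
  by (auto simp: frac_def)

lemma finite_support_Icc:
  assumes "circle_chain f"
  shows "finite {t \<in> {a..b}. f t \<noteq> 0}"
proof (rule finite_subset)
  show "{t \<in> {a..b}. f t \<noteq> 0} \<subseteq>
      (\<Union>m\<in>{\<lfloor>a\<rfloor>..\<lfloor>b\<rfloor>}. (\<lambda>x. x + of_int m) ` {t \<in> {0..<1}. f t \<noteq> 0})"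
  proof
    fix t assume t: "t \<in> {t \<in> {a..b}. f t \<noteq> 0}"
    have "f (frac t) = f t"
      by (rule circle_chain_cong_Ints[OF assms]) (rule minus_frac_in_Ints)
    moreover have "t = frac t + of_int \<lfloor>t\<rfloor>" by (simp add: frac_def)
    moreover have "\<lfloor>t\<rfloor> \<in> {\<lfloor>a\<rfloor>..\<lfloor>b\<rfloor>}" using t by (auto intro: floor_mono)
    ultimately show "t \<in> (\<Union>m\<in>{\<lfloor>a\<rfloor>..\<lfloor>b\<rfloor>}. (\<lambda>x. x + of_int m) ` {t \<in> {0..<1}. f t \<noteq> 0})"
      using t by (auto intro!: bexI[of _ "\<lfloor>t\<rfloor>"] image_eqI[of _ _ "frac t"] simp: frac_lt_1)
  qed
  show "finite (\<Union>m\<in>{\<lfloor>a\<rfloor>..\<lfloor>b\<rfloor>}. (\<lambda>x. x + of_int m) ` {t \<in> {0..<1}. f t \<noteq> 0})"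
    using assms by (auto simp: circle_chain_def)
qed

lemma finite_support_subset:
  assumes "circle_chain f" "A \<subseteq> {a..b}"
  shows "finite {t \<in> A. f t \<noteq> 0}"
  by (rule finite_subset[OF _ finite_support_Icc[OF assms(1), of a b]]) (use assms(2) in auto)

lemma finite_support_Ico:
  assumes "circle_chain f"
  shows "finite {t \<in> {a..<b}. f t \<noteq> 0}"
  by (rule finite_support_subset[OF assms, of _ a b]) auto

text \<open>\<open>frac\<close> matches the support in B with the support in [0, 1). The set B need
  not be an interval: it serves as a shifted period and as a union of arcs of strands.\<close>

lemma circle_sum_eq_sum':
  assumes f: "circle_chain f" and inj: "inj_on frac B"
    and cover: "\<And>t. f t \<noteq> 0 \<Longrightarrow> \<exists>b\<in>B. t - b \<in> \<int>"
  shows "circle_sum f = sum' f B"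
proof -
  let ?S = "{t \<in> {0..<1}. f t \<noteq> 0}" and ?T = "{b \<in> B. f b \<noteq> 0}"
  have fr: "f (frac t) = f t" for t
    by (rule circle_chain_cong_Ints[OF f]) (rule minus_frac_in_Ints)
  have bij: "bij_betw frac ?T ?S"
    unfolding bij_betw_def
  proof
    show "inj_on frac ?T" using inj by (rule inj_on_subset) auto
    show "frac ` ?T = ?S"
    proof (intro equalityI subsetI)
      fix t assume t: "t \<in> ?S"
      then obtain b where b: "b \<in> B" "t - b \<in> \<int>" using cover by blast
      have "b - t \<in> \<int>" using Ints_minus[OF b(2)] by simp
      then have "frac b = t" unfolding frac_unique_iff using t by simp
      moreover have "f b = f t" using circle_chain_cong_Ints[OF f b(2)] by simp
      ultimately show "t \<in> frac ` ?T" using b t by auto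
    qed (auto simp: fr frac_lt_1)
  qed
  have finS: "finite ?S" using f by (simp add: circle_chain_def)
  have finT: "finite ?T" using bij_betw_finite[OF bij] finS by simp
  have "sum (\<lambda>x. f (frac x)) ?T = sum f ?S"
    by (rule sum.reindex_bij_betw[OF bij])
  then have "sum f ?T = sum f ?S" by (simp add: fr)
  moreover have "sum' f {0..<1} = sum f ?S" by (rule sum'_eq_sum) (use finS in auto)
  moreover have "sum' f B = sum f ?T" by (rule sum'_eq_sum) (use finT in auto)
  ultimately show ?thesis by (simp add: circle_sum_def)
qed

lemma circle_sum_Ico:
  assumes f: "circle_chain f"
  shows "circle_sum f = sum' f {x..<x + 1}"
proof (rule circle_sum_eq_sum'[OF f])
  show "inj_on frac {x..<x + 1}" using bij_betw_frac[of x] by (simp add: bij_betw_def)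
  fix t :: real
  have "frac t \<in> frac ` {x..<x + 1}"
    using bij_betw_frac[of x] by (auto simp: bij_betw_def frac_lt_1)
  then obtain b where "b \<in> {x..<x + 1}" "frac b = frac t" by auto
  then show "\<exists>b\<in>{x..<x + 1}. t - b \<in> \<int>"
    by (auto elim!: frac_eqE intro!: bexI[of _ b])
qed

text \<open>The analogue of the fundamental theorem of calculus. There are three cases for the
  position of 0, since \<open>primitive\<close> is given by different sums on the two sides of
  0.\<close>

lemma primitive_diff:
  assumes g: "circle_chain g" and "x \<le> y"
  shows "primitive g y = primitive g x + sum' g {x..<y}"
proof -
  have split: "sum' g {a..<c} = sum' g {a..<b} + sum' g {b..<c}" if "a \<le> b" "b \<le> c" for a b c
  proof -
    have "{a..<c} = {a..<b} \<union> {b..<c}" using that by auto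
    moreover have "sum' g ({a..<b} \<union> {b..<c}) = sum' g {a..<b} + sum' g {b..<c}"
      by (intro sum'_Un_disjoint finite_support_subset[OF g, where a = a and b = c])
        (use that in auto)
    ultimately show ?thesis by simp
  qed
  consider "0 \<le> x" | "x < 0" "0 \<le> y" | "y < 0" by linarith
  then show ?thesis
  proof cases
    case 1
    then show ?thesis using split[of 0 x y] \<open>x \<le> y\<close> by (simp add: primitive_def)
  next
    case 2
    then show ?thesis using split[of x 0 y] by (simp add: primitive_def)
  next
    case 3
    then show ?thesis using split[of x y 0] \<open>x \<le> y\<close> by (simp add: primitive_def)
  qed
qed

lemma primitive_periodic:
  assumes "circle_chain g" "circle_sum g = 0"
  shows "primitive g (x + 1) = primitive g x"
  using primitive_diff[OF assms(1), of x "x + 1"] circle_sum_Ico[OF assms(1), of x] assms(2)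
  by linarith

lemma circle_chain_mult:
  assumes f: "circle_chain f" and h: "\<And>t. h (t + 1) = h t"
  shows "circle_chain (\<lambda>t. f t * h t)"
proof -
  have "{t \<in> {0..<1}. f t * h t \<noteq> 0} \<subseteq> {t \<in> {0..<1}. f t \<noteq> 0}" by auto
  then show ?thesis using f h by (auto simp: circle_chain_def intro: finite_subset)
qed

lemma circle_chain_diff:
  assumes f: "circle_chain f" and g: "circle_chain g"
  shows "circle_chain (\<lambda>t. f t - g t)"
proof -
  have "{t \<in> {0..<1}. f t - g t \<noteq> 0} \<subseteq> {t \<in> {0..<1}. f t \<noteq> 0} \<union> {t \<in> {0..<1}. g t \<noteq> 0}" by auto
  then show ?thesis using f g by (auto simp: circle_chain_def intro: finite_subset)
qed

lemma circle_sum_diff: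
  assumes "circle_chain f" "circle_chain g"
  shows "circle_sum (\<lambda>t. f t - g t) = circle_sum f - circle_sum g"
proof -
  have eq: "circle_sum h = sum h ({t \<in> {0..<1}. f t \<noteq> 0} \<union> {t \<in> {0..<1}. g t \<noteq> 0})"
    if "\<And>t. f t = 0 \<Longrightarrow> g t = 0 \<Longrightarrow> h t = 0" for h
    unfolding circle_sum_def
    by (rule sum'_eq_sum) (use assms that in \<open>auto simp: circle_chain_def\<close>)
  show ?thesis
    by (subst (1 2 3) eq) (simp_all add: sum_subtractf)
qed

text \<open>The half-open interval in \<open>primitive\<close> makes the order strict: the value at
  s collects the points of [0, 1) before s and omits s itself.\<close>

lemma pairing_eq_double_sum:
  assumes f: "circle_chain f" and g: "circle_chain g"
  shows "pairing f g = (\<Sum>s | s \<in> {0..<1} \<and> f s \<noteq> 0. \<Sum>t | t \<in> {0..<1} \<and> g t \<noteq> 0.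
           f s * g t * of_bool (t < s))"
proof -
  have fin: "finite {s \<in> {0..<1}. f s \<noteq> 0}" "finite {s \<in> {0..<1}. g s \<noteq> 0}"
    using f g by (auto simp: circle_chain_def)
  have prim: "primitive g s = (\<Sum>t | t \<in> {0..<1} \<and> g t \<noteq> 0. g t * of_bool (t < s))"
    if "s \<in> {0..<1}" for s
  proof -
    have "primitive g s = sum' g {0..<s}" using that by (simp add: primitive_def)
    also have "\<dots> = sum g {t \<in> {0..<s}. g t \<noteq> 0}"
      by (rule sum'_eq_sum) (use finite_support_Ico[OF g, of 0 s] in auto)
    also have "\<dots> = (\<Sum>t | t \<in> {0..<1} \<and> g t \<noteq> 0. g t * of_bool (t < s))"
      by (rule sum.mono_neutral_cong_left) (use fin that in auto)
    finally show ?thesis .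
  qed
  have "pairing f g = (\<Sum>s | s \<in> {0..<1} \<and> f s \<noteq> 0. f s * primitive g s)"
    unfolding pairing_def circle_sum_def
    by (rule sum'_eq_sum) (use fin in auto)
  also have "\<dots> = (\<Sum>s | s \<in> {0..<1} \<and> f s \<noteq> 0. \<Sum>t | t \<in> {0..<1} \<and> g t \<noteq> 0.
           f s * g t * of_bool (t < s))"
    by (rule sum.cong) (simp_all add: prim sum_distrib_left mult.assoc)
  finally show ?thesis .
qed

text \<open>The product of the total sums is zero and splits by the order of s and t; disjoint
  supports leave nothing on the diagonal.\<close>

lemma pairing_antisym:
  assumes f: "circle_chain f" "circle_sum f = 0" and g: "circle_chain g"
    and fg: "\<And>t. f t * g t = 0"
  shows "pairing g f = - pairing f g"
proof -
  let ?F = "{s. s \<in> {0..<1} \<and> f s \<noteq> 0}" and ?G = "{s. s \<in> {0..<1} \<and> g s \<noteq> 0}"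
  have fin: "finite ?F" "finite ?G"
    using f g by (auto simp: circle_chain_def)
  have "sum f ?F = circle_sum f"
    unfolding circle_sum_def by (rule sum'_eq_sum[symmetric]) (use fin in auto)
  then have "sum f ?F = 0" using f by simp
  then have "0 = sum f ?F * sum g ?G" by simp
  also have "\<dots> = (\<Sum>s\<in>?F. \<Sum>t\<in>?G. f s * g t)" by (rule sum_product)
  also have "\<dots> = (\<Sum>s\<in>?F. \<Sum>t\<in>?G. f s * g t * of_bool (t < s) + g t * f s * of_bool (s < t))"
  proof (intro sum.cong refl)
    fix s t
    show "f s * g t = f s * g t * of_bool (t < s) + g t * f s * of_bool (s < t)"
      using fg[of s] by (cases s t rule: linorder_cases) auto
  qed
  also have "\<dots> = pairing f g + (\<Sum>s\<in>?F. \<Sum>t\<in>?G. g t * f s * of_bool (s < t))"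
    by (simp only: sum.distrib pairing_eq_double_sum[OF f(1) g])
  also have "(\<Sum>s\<in>?F. \<Sum>t\<in>?G. g t * f s * of_bool (s < t)) = pairing g f"
    unfolding pairing_eq_double_sum[OF g f(1)] by (rule sum.swap)
  finally show ?thesis by simp
qed

lemma inj_on_frac_iff: "inj_on frac B \<longleftrightarrow> (\<forall>s\<in>B. \<forall>t\<in>B. s - t \<in> \<int> \<longrightarrow> s = (t::real))"
proof -
  have "frac s = frac t \<longleftrightarrow> s - t \<in> \<int>" for s t :: real
    using frac_add_int_right[of "s - t" t] by (auto elim!: frac_eqE)
  then show ?thesis by (auto simp: inj_on_def)
qed

text \<open>The map \<phi> may move the cut at 0, so the primitives differ by a constant; this
  constant is multiplied by the sum of f, which vanishes.\<close>

lemma pairing_reparametrize: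
  assumes mono: "strict_mono \<phi>" and surj: "surj \<phi>" and per: "\<And>t. \<phi> (t + 1) = \<phi> t + (1::real)"
    and f: "circle_chain f" and g: "circle_chain g" and f': "circle_chain f'" and g': "circle_chain g'"
    and sums: "circle_sum f = 0" "circle_sum g' = 0"
    and ff: "\<And>t. f' (\<phi> t) = f t" and gg: "\<And>t. g' (\<phi> t) = g t"
  shows "pairing f' g' = pairing f g"
proof -
  have inj: "inj_on \<phi> A" for A using mono by (meson inj_on_subset strict_mono_imp_inj_on subset_UNIV)
  have img: "\<phi> ` {a..<b} = {\<phi> a..<\<phi> b}" for a b
  proof (intro equalityI subsetI)
    fix y assume y: "y \<in> {\<phi> a..<\<phi> b}"
    obtain x where "y = \<phi> x" using surj by (auto simp: surj_def)
    then show "y \<in> \<phi> ` {a..<b}"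
      using y mono by (auto simp: strict_mono_less strict_mono_less_eq)
  qed (use mono in \<open>auto simp: strict_mono_less strict_mono_less_eq\<close>)
  have sumr: "sum' h (\<phi> ` {a..<b}) = sum' (\<lambda>x. h (\<phi> x)) {a..<b}"
    if "finite {t \<in> {a..<b}. h (\<phi> t) \<noteq> 0}" for h a b
  proof -
    have "sum' h (\<phi> ` {a..<b}) = sum h (\<phi> ` {t \<in> {a..<b}. h (\<phi> t) \<noteq> 0})"
      by (rule sum'_eq_sum) (use that in auto)
    also have "\<dots> = sum (\<lambda>x. h (\<phi> x)) {t \<in> {a..<b}. h (\<phi> t) \<noteq> 0}"
      by (simp add: sum.reindex[OF inj])
    also have "\<dots> = sum' (\<lambda>x. h (\<phi> x)) {a..<b}"
      by (rule sum'_eq_sum[symmetric]) (use that in auto)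
    finally show ?thesis .
  qed
  define K where "K = primitive g' (\<phi> 0)"
  have prim: "primitive g' (\<phi> x) = K + primitive g x" if "0 \<le> x" for x
  proof -
    have "primitive g' (\<phi> x) = K + sum' g' {\<phi> 0..<\<phi> x}"
      unfolding K_def using that mono by (intro primitive_diff[OF g']) (simp add: strict_mono_less_eq)
    also have "sum' g' {\<phi> 0..<\<phi> x} = sum' (\<lambda>x. g' (\<phi> x)) {0..<x}"
      unfolding img[symmetric]
      by (rule sumr) (use finite_support_Ico[OF g, of 0 x] gg in auto)
    also have "\<dots> = primitive g x" using that by (simp add: primitive_def gg)
    finally show ?thesis .
  qed
  have chain: "circle_chain (\<lambda>x. f' x * primitive g' x)"
    by (intro circle_chain_mult f' primitive_periodic g' sums)
  have fin: "finite {t \<in> {0..<1}. f t \<noteq> 0}" using f by (simp add: circle_chain_def)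
  \<comment> \<open>The period starting at \<phi> 0 is the image of [0, 1), and it may replace [0,
    1) because the primitive of g' is periodic.\<close>
  have "pairing f' g' = sum' (\<lambda>x. f' x * primitive g' x) (\<phi> ` {0..<1})"
    unfolding pairing_def using circle_sum_Ico[OF chain, of "\<phi> 0"] per[of 0] by (simp add: img)
  also have "\<dots> = sum' (\<lambda>x. f' (\<phi> x) * primitive g' (\<phi> x)) {0..<1}"
    by (rule sumr, rule finite_subset[OF _ fin]) (auto simp: ff)
  also have "\<dots> = sum (\<lambda>x. f' (\<phi> x) * primitive g' (\<phi> x)) {t \<in> {0..<1}. f t \<noteq> 0}"
    by (rule sum'_eq_sum) (use fin ff in auto)
  also have "\<dots> = sum (\<lambda>x. K * f x + f x * primitive g x) {t \<in> {0..<1}. f t \<noteq> 0}"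
    by (rule sum.cong) (simp_all add: ff prim algebra_simps)
  also have "\<dots> = K * sum f {t \<in> {0..<1}. f t \<noteq> 0} + sum (\<lambda>x. f x * primitive g x) {t \<in> {0..<1}. f t \<noteq> 0}"
    by (simp add: sum.distrib sum_distrib_left)
  also have "sum f {t \<in> {0..<1}. f t \<noteq> 0} = circle_sum f"
    unfolding circle_sum_def by (rule sum'_eq_sum[symmetric]) (use fin in auto)
  also have "sum (\<lambda>x. f x * primitive g x) {t \<in> {0..<1}. f t \<noteq> 0} = pairing f g"
    unfolding pairing_def circle_sum_def by (rule sum'_eq_sum[symmetric]) (use fin in auto)
  finally show ?thesis using sums by simp
qed

section \<open>Changes of a chain on the arcs of a local move\<close>

lemma strand_layout_separated:
  assumes "strand_layout n c e r" "k < n" "l < n" "\<bar>x\<bar> \<le> r" "\<bar>y\<bar> \<le> r"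
    and "(c k + x) - (c l + y) \<in> \<int>"
  shows "k = l \<and> x = y"
proof -
  from assms(6) obtain m where m: "(c k + x) - (c l + y) = of_int m" by (auto elim: Ints_cases)
  have "\<bar>c k - c l - of_int m\<bar> \<le> 2 * r"
    using m assms(4,5) by linarith
  then have "k = l \<and> m = 0"
    using assms(1-3) unfolding strand_layout_def by (metis not_less)
  then show ?thesis using m by simp
qed

text \<open>The pairing is linear in its first argument, so the difference sums f' - f against a
  fixed periodic function. The arcs are disjoint modulo 1, hence their union injects into the circle
  and catches the support of f' - f.\<close>

lemma pairing_local_change:
  assumes lay: "strand_layout n c e r"
    and f: "circle_chain f" and f': "circle_chain f'" and g: "circle_chain g" "circle_sum g = 0"
    and outer: "\<And>t. \<not> inner_param n c r t \<Longrightarrow> f' t = f t"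
  shows "pairing f' g = pairing f g +
     (\<Sum>k<n. sum' (\<lambda>s. (f' s - f s) * primitive g s) {c k - r..c k + r})"
proof -
  note per = primitive_periodic[OF g]
  let ?d = "\<lambda>s. (f' s - f s) * primitive g s"
  let ?B = "\<Union>k<n. {c k - r..c k + r}"
  have chain: "circle_chain ?d" by (intro circle_chain_mult circle_chain_diff f f' per)
  have "circle_sum ?d = sum' ?d ?B"
  proof (rule circle_sum_eq_sum'[OF chain])
    show "inj_on frac ?B"
      unfolding inj_on_frac_iff
    proof (intro ballI impI)
      fix s t assume "s \<in> ?B" "t \<in> ?B" "s - t \<in> \<int>"
      then obtain k l where "k < n" "l < n" "\<bar>s - c k\<bar> \<le> r" "\<bar>t - c l\<bar> \<le> r" by force
      then show "s = t"
        using strand_layout_separated[OF lay, of k l "s - c k" "t - c l"] \<open>s - t \<in> \<int>\<close> by force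
    qed
    fix t assume "?d t \<noteq> 0"
    then have "inner_param n c r t" using outer by fastforce
    then obtain k m where "k < n" "\<bar>t - c k - of_int m\<bar> \<le> r" by (auto simp: inner_param_def)
    then show "\<exists>b\<in>?B. t - b \<in> \<int>"
      by (intro bexI[of _ "t - of_int m"]) (auto intro!: bexI[of _ k] simp: abs_le_iff)
  qed
  also have "\<dots> = (\<Sum>k<n. sum' ?d {c k - r..c k + r})"
  proof (rule sum'_UN_disjoint)
    fix k l assume kl: "k < n" "l < n" "k \<noteq> l"
    show "{c k - r..c k + r} \<inter> {c l - r..c l + r} = {}"
    proof (rule ccontr)
      assume "{c k - r..c k + r} \<inter> {c l - r..c l + r} \<noteq> {}"
      then obtain t where "t \<in> {c k - r..c k + r}" "t \<in> {c l - r..c l + r}" by blast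
      then have "\<bar>t - c k\<bar> \<le> r" "\<bar>t - c l\<bar> \<le> r" by auto
      then show False
        using strand_layout_separated[OF lay kl(1,2), of "t - c k" "t - c l"] kl(3) by simp
    qed
  qed (rule finite_support_Icc[OF chain])
  also have "circle_sum ?d = pairing f' g - pairing f g"
    unfolding pairing_def
    by (subst circle_sum_diff[symmetric])
      (auto intro!: circle_chain_mult f f' per simp: algebra_simps)
  finally show ?thesis by simp
qed

lemma primitive_const:
  assumes "circle_chain g" "\<And>t. t \<in> {x..<y} \<Longrightarrow> g t = 0" "x \<le> y"
  shows "primitive g y = primitive g x"
proof -
  have "sum' g {x..<y} = sum g {}" by (rule sum'_eq_sum) (use assms in auto)
  then show ?thesis using primitive_diff[OF assms(1,3)] by simp
qed

section \<open>Intersections of chords of the circle\<close>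

lemma cross2_simps:
  "cross2 (v + w) u = cross2 v u + cross2 w u"
  "cross2 u (v + w) = cross2 u v + cross2 u w"
  "cross2 (v - w) u = cross2 v u - cross2 w u"
  "cross2 u (v - w) = cross2 u v - cross2 u w"
  "cross2 (a *\<^sub>R v) w = a * cross2 v w"
  "cross2 v (a *\<^sub>R w) = a * cross2 v w"
  "cross2 v v = 0"
  by (simp_all add: cross2_def algebra_simps)

lemma cross2_swap: "cross2 w v = - cross2 v w"
  by (simp add: cross2_def)

lemma diff_in_Ints_Ico: "s \<in> {0..<1} \<Longrightarrow> t \<in> {0..<1::real} \<Longrightarrow> s - t \<in> \<int> \<Longrightarrow> s = t"
proof -
  assume st: "s \<in> {0..<1}" "t \<in> {0..<1}" "s - t \<in> \<int>"
  then obtain m where m: "s - t = of_int m" by (auto elim: Ints_cases)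
  then have "\<bar>real_of_int m\<bar> < 1" using st by auto
  then have "m = 0" by linarith
  then show "s = t" using m by simp
qed

text \<open>The signed form of the area formula 2 sin A sin B sin C for a triangle inscribed in the
  unit circle, doubled.\<close>

lemma cross2_circle_point:
  "cross2 (circle_point b - circle_point a) (circle_point x - circle_point a) =
     4 * sin (pi * (b - a)) * sin (pi * (x - b)) * sin (pi * (x - a))"
proof -
  have minus: "sin (pi * (a - y)) = - sin (pi * (y - a))" for y
    using sin_minus[of "pi * (y - a)"] by (simp add: algebra_simps)
  have cd: "cos (2 * pi * y) - cos (2 * pi * a) = - 2 * sin (pi * (y + a)) * sin (pi * (y - a))"
    and sd: "sin (2 * pi * y) - sin (2 * pi * a) = 2 * sin (pi * (y - a)) * cos (pi * (y + a))" for y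
  proof -
    have half: "(2 * pi * y + 2 * pi * a) / 2 = pi * (y + a)" "(2 * pi * a - 2 * pi * y) / 2 = pi * (a - y)"
      "(2 * pi * y - 2 * pi * a) / 2 = pi * (y - a)"
      by (simp_all add: field_simps)
    show "cos (2 * pi * y) - cos (2 * pi * a) = - 2 * sin (pi * (y + a)) * sin (pi * (y - a))"
      unfolding cos_diff_cos half minus by simp
    show "sin (2 * pi * y) - sin (2 * pi * a) = 2 * sin (pi * (y - a)) * cos (pi * (y + a))"
      unfolding sin_diff_sin half by simp
  qed
  have sb: "sin (pi * (x - b)) = sin (pi * (x + a)) * cos (pi * (b + a)) - cos (pi * (x + a)) * sin (pi * (b + a))"
  proof -
    have "pi * (x - b) = pi * (x + a) - pi * (b + a)" by (simp add: algebra_simps)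
    then show ?thesis by (simp only: sin_diff)
  qed
  show ?thesis
    unfolding cross2_def circle_point_def minus_complex.sel cis.sel cd sd sb
    by (simp only: mult_ac algebra_simps)
qed

lemma sin_pi_pos_iff: "\<bar>x\<bar> < 1 \<Longrightarrow> 0 < sin (pi * x) \<longleftrightarrow> 0 < x"
  and sin_pi_neg_iff: "\<bar>x\<bar> < 1 \<Longrightarrow> sin (pi * x) < 0 \<longleftrightarrow> x < 0"
proof -
  have pos: "0 < sin (pi * x)" if "0 < x" "x < 1" for x
    using that by (intro sin_gt_zero) auto
  have neg: "sin (pi * x) < 0" if "-1 < x" "x < 0" for x
    using pos[of "- x"] that by simp
  show "\<bar>x\<bar> < 1 \<Longrightarrow> 0 < sin (pi * x) \<longleftrightarrow> 0 < x" "\<bar>x\<bar> < 1 \<Longrightarrow> sin (pi * x) < 0 \<longleftrightarrow> x < 0"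
    using pos[of x] neg[of x] by (cases x "0::real" rule: linorder_cases; force)+
qed

text \<open>In particular \<open>orient 0 x\<close> is the sign of \<open>x\<close> as an integer.\<close>

definition orient :: "real \<Rightarrow> real \<Rightarrow> int" where
  "orient s t = of_bool (s < t) - of_bool (t < s)"

text \<open>The side of the chord on which x lies reflects the cyclic order of the three points.
  Written in the linear order of [0, 1) it acquires the term \<open>of_bool (a < b)\<close>, which
  does not depend on x and cancels when two points are compared.\<close>

lemma circle_point_side:
  assumes "a \<in> {0..<1}" "b \<in> {0..<1}" "x \<in> {0..<1}" "a \<noteq> b" "x \<noteq> a" "x \<noteq> b"
  defines "l \<equiv> cross2 (circle_point b - circle_point a) (circle_point x - circle_point a)"
  shows "l \<noteq> 0" "orient a x - orient b x = 2 * of_bool (a < b) - 2 * of_bool (0 < l)"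
proof -
  have sg: "(0 < sin (pi * (y - z)) \<longleftrightarrow> z < y) \<and> (sin (pi * (y - z)) < 0 \<longleftrightarrow> y < z)"
    if "y \<in> {0..<1}" "z \<in> {0..<1}" for y z
    using that sin_pi_pos_iff[of "y - z"] sin_pi_neg_iff[of "y - z"] by auto
  note sgs = sg[OF assms(2,1)] sg[OF assms(3,2)] sg[OF assms(3,1)]
  show "l \<noteq> 0"
    unfolding l_def cross2_circle_point mult_eq_0_iff using sgs assms(4-6) by force
  have "0 < l \<longleftrightarrow> 0 < sin (pi * (b - a)) * sin (pi * (x - b)) * sin (pi * (x - a))"
    unfolding l_def cross2_circle_point by (simp add: zero_less_mult_iff)
  also have "\<dots> \<longleftrightarrow> (if a < b then x < a \<or> b < x else b < x \<and> x < a)"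
    unfolding zero_less_mult_iff mult_less_0_iff using sgs assms(4-6) by auto
  finally show "orient a x - orient b x = 2 * of_bool (a < b) - 2 * of_bool (0 < l)"
    using assms(4-6) by (auto simp: orient_def)
qed

text \<open>C and D lie strictly on the same side of the line through A and B, and a convex
  combination of two values of one sign keeps this sign.\<close>

lemma closed_segments_disjoint:
  assumes "0 < cross2 (B - A) (C - A) * cross2 (B - A) (D - A)"
  shows "closed_segment A B \<inter> closed_segment C D = {}"
proof (rule ccontr)
  assume "closed_segment A B \<inter> closed_segment C D \<noteq> {}"
  then obtain u v where uv: "(1 - u) *\<^sub>R A + u *\<^sub>R B = (1 - v) *\<^sub>R C + v *\<^sub>R D" "0 \<le> v" "v \<le> 1"
    by (auto simp: in_segment)
  have "u *\<^sub>R (B - A) = (1 - v) *\<^sub>R (C - A) + v *\<^sub>R (D - A)"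
    using uv(1) by (simp add: algebra_simps)
  then have "cross2 (B - A) (u *\<^sub>R (B - A)) = cross2 (B - A) ((1 - v) *\<^sub>R (C - A) + v *\<^sub>R (D - A))"
    by simp
  then have zero: "0 = (1 - v) * cross2 (B - A) (C - A) + v * cross2 (B - A) (D - A)"
    by (simp only: cross2_simps)
  consider (pos) "0 < cross2 (B - A) (C - A)" "0 < cross2 (B - A) (D - A)"
    | (neg) "cross2 (B - A) (C - A) < 0" "cross2 (B - A) (D - A) < 0"
    using assms by (auto simp: zero_less_mult_iff)
  then show False
  proof cases
    case pos
    then have "0 < (1 - v) * cross2 (B - A) (C - A) + v * cross2 (B - A) (D - A)"
      using uv by (cases "v = 0") (auto intro: add_nonneg_pos)
    then show ?thesis using zero by simp
  next
    case neg
    then have "(1 - v) * cross2 (B - A) (C - A) + v * cross2 (B - A) (D - A) < 0"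
      using uv by (cases "v = 0") (auto intro!: add_nonpos_neg mult_nonneg_nonpos mult_pos_neg)
    then show ?thesis using zero by simp
  qed
qed

lemma closed_segments_meet:
  assumes 1: "cross2 (B - A) (C - A) * cross2 (B - A) (D - A) < 0"
    and 2: "cross2 (D - C) (A - C) * cross2 (D - C) (B - C) < 0"
  shows "closed_segment A B \<inter> closed_segment C D \<noteq> {}"
proof -
  \<comment> \<open>Cramer's rule for the intersection of the two lines; the two separation
    hypotheses place both parameters between 0 and 1.\<close>
  define K where "K = cross2 (B - A) (D - C)"
  define u where "u = cross2 (D - C) (A - C) / K"
  define v where "v = - cross2 (B - A) (C - A) / K"
  have K1: "K = cross2 (B - A) (D - A) - cross2 (B - A) (C - A)"
    unfolding K_def by (simp add: cross2_def algebra_simps)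
  have K2: "K = cross2 (D - C) (A - C) - cross2 (D - C) (B - C)"
    unfolding K_def by (simp add: cross2_def algebra_simps)
  have "0 \<le> u \<and> u \<le> 1"
    using 2 unfolding u_def K2 by (auto simp: mult_less_0_iff divide_simps)
  moreover have "0 \<le> v \<and> v \<le> 1"
    using 1 unfolding v_def K1 by (auto simp: mult_less_0_iff divide_simps)
  moreover have "(1 - u) *\<^sub>R A + u *\<^sub>R B = (1 - v) *\<^sub>R C + v *\<^sub>R D"
  proof -
    have "K \<noteq> 0" using 1 unfolding K1 by (auto simp: mult_less_0_iff)
    then have "K *\<^sub>R ((1 - u) *\<^sub>R A + u *\<^sub>R B) = K *\<^sub>R A + cross2 (D - C) (A - C) *\<^sub>R (B - A)"
      "K *\<^sub>R ((1 - v) *\<^sub>R C + v *\<^sub>R D) = K *\<^sub>R C - cross2 (B - A) (C - A) *\<^sub>R (D - C)"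
      unfolding u_def v_def by (simp_all add: complex_eq_iff field_simps)
    moreover have "K *\<^sub>R A + cross2 (D - C) (A - C) *\<^sub>R (B - A) = K *\<^sub>R C - cross2 (B - A) (C - A) *\<^sub>R (D - C)"
      unfolding K_def by (simp add: complex_eq_iff cross2_def algebra_simps)
    ultimately show ?thesis using \<open>K \<noteq> 0\<close> by (metis scaleR_left_imp_eq)
  qed
  ultimately show ?thesis by (force simp: in_segment)
qed

text \<open>By \<open>circle_point_side\<close> the right-hand side is 0 if c and d are on the same
  side of the chord from a to b, and 2 or -2 otherwise. The factor 2 avoids halving
  integers.\<close>

lemma chord_crossing_sign:
  assumes "a \<in> {0..<1}" "b \<in> {0..<1}" "c \<in> {0..<1}" "d \<in> {0..<1}"
    and "a \<noteq> b" "a \<noteq> c" "a \<noteq> d" "b \<noteq> c" "b \<noteq> d" "c \<noteq> d"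
  shows "2 * (if chord_segment (a, b) \<inter> chord_segment (c, d) \<noteq> {} then chord_sign (a, b) (c, d) else 0) =
    orient a c - orient b c - (orient a d - orient b d)"
proof -
  define A B C D where "A = circle_point a" "B = circle_point b" "C = circle_point c" "D = circle_point d"
  note ABCD = this
  let ?lC = "cross2 (B - A) (C - A)" and ?lD = "cross2 (B - A) (D - A)"
    and ?mA = "cross2 (D - C) (A - C)" and ?mB = "cross2 (D - C) (B - C)"
  note C = circle_point_side[of a b c, folded ABCD] and D = circle_point_side[of a b d, folded ABCD]
  note A = circle_point_side[of c d a, folded ABCD] and B = circle_point_side[of c d b, folded ABCD]
  have nonzero: "?lC \<noteq> 0" "?lD \<noteq> 0" "?mA \<noteq> 0" "?mB \<noteq> 0"
    by (rule C(1) D(1) A(1) B(1); use assms in simp)+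
  \<comment> \<open>If C and D are separated by the first chord, the frame of the chord vectors is
    therefore positive exactly when D is on its left and C on its right.\<close>
  have K: "cross2 (B - A) (D - C) = ?lD - ?lC"
    by (simp add: cross2_def algebra_simps)
  let ?r = "orient a c - orient b c - (orient a d - orient b d)"
  have r1: "?r = 2 * of_bool (0 < ?lD) - 2 * of_bool (0 < ?lC)"
    using C(2) D(2) assms by simp
  \<comment> \<open>The antisymmetry of \<open>orient\<close> exchanges the roles of the chords. So
    A and B are separated by the second chord as soon as C and D are separated by the first.\<close>
  have "?r = (orient c b - orient d b) - (orient c a - orient d a)"
    by (simp add: orient_def)
  then have r2: "?r = 2 * of_bool (0 < ?mA) - 2 * of_bool (0 < ?mB)"
    using A(2) B(2) assms by simp
  show ?thesis
  proof (cases "0 < ?lC \<longleftrightarrow> 0 < ?lD")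
    case True
    then have "0 < ?lC * ?lD" using nonzero by (auto simp: zero_less_mult_iff)
    then have "chord_segment (a, b) \<inter> chord_segment (c, d) = {}"
      unfolding chord_segment_def fst_conv snd_conv ABCD[symmetric]
      by (rule closed_segments_disjoint)
    then show ?thesis using r1 True by simp
  next
    case False
    then have l: "?lC * ?lD < 0" using nonzero by (auto simp: mult_less_0_iff)
    have "(0 < ?mA) \<noteq> (0 < ?mB)" using r1 r2 False
      by (cases "0 < ?mA"; cases "0 < ?mB"; cases "0 < ?lC"; cases "0 < ?lD") auto
    then have m: "?mA * ?mB < 0" using nonzero by (auto simp: mult_less_0_iff)
    have meet: "chord_segment (a, b) \<inter> chord_segment (c, d) \<noteq> {}"
      unfolding chord_segment_def fst_conv snd_conv ABCD[symmetric]
      by (rule closed_segments_meet[OF l m])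
    have "chord_sign (a, b) (c, d) = (if 0 < ?lD then 1 else -1)"
      unfolding chord_sign_def chord_vector_def fst_conv snd_conv ABCD[symmetric] K
      using l by (auto simp: mult_less_0_iff)
    then show ?thesis using meet r1 False by simp
  qed
qed

section \<open>Intersection numbers as pairings of chains\<close>

lemma curve_cong: "mv_diagram T D \<Longrightarrow> s - t \<in> \<int> \<Longrightarrow> curve D s = curve D t"
  and mark_cong: "mv_diagram T D \<Longrightarrow> s - t \<in> \<int> \<Longrightarrow> mark D s = mark D t"
proof -
  assume D: "mv_diagram T D"
  have step: "curve D (t + 1) = curve D t" "mark D (t + 1) = mark D t" for t
    using D by (auto simp: mv_diagram_def)
  have int: "curve D (t + of_int m) = curve D t \<and> mark D (t + of_int m) = mark D t" for t m
  proof (induction m rule: int_induct[where k = 0])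
    case (step1 i)
    then show ?case using step[of "t + of_int i"] by (simp add: algebra_simps)
  next
    case (step2 i)
    then show ?case using step[of "t + of_int (i - 1)"] by (simp add: algebra_simps)
  qed simp
  assume "s - t \<in> \<int>"
  then obtain m where "s - t = of_int m" by (auto elim: Ints_cases)
  then have "s = t + of_int m" by simp
  then show "curve D s = curve D t" "mark D s = mark D t" using int by auto
qed

lemma curve_has_velocity:
  "mv_diagram T D \<Longrightarrow> (curve D has_vector_derivative velocity D t) (at t)"
  unfolding velocity_def
  by (simp add: mv_diagram_def C1_differentiable_on_eq vector_derivative_works)

lemma velocity_cong:
  assumes D: "mv_diagram T D" and st: "s - t \<in> \<int>"
  shows "velocity D s = velocity D t"
proof -
  have "curve D \<circ> (\<lambda>x. x + (s - t)) = curve D"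
    using curve_cong[OF D] st by (auto simp: fun_eq_iff)
  moreover have "(curve D \<circ> (\<lambda>x. x + (s - t)) has_vector_derivative (1 *\<^sub>R velocity D s)) (at t)"
    by (rule vector_diff_chain_at)
      (auto intro!: derivative_eq_intros curve_has_velocity[OF D])
  ultimately show ?thesis
    unfolding velocity_def[of D t] by (simp add: vector_derivative_at)
qed

text \<open>Ends are described at all real parameters, whereas \<open>virtual_chords\<close> keeps
  to [0, 1). They are thus periodic and can be carried along reparametrizations that move the base
  point.\<close>

definition tail_at :: "diagram \<Rightarrow> nat \<Rightarrow> real \<Rightarrow> bool" where
  "tail_at D i t \<longleftrightarrow> mark D t = Virt i \<and>
     (\<exists>s. s - t \<notin> \<int> \<and> curve D s = curve D t \<and> 0 < cross2 (velocity D t) (velocity D s))"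

definition head_at :: "diagram \<Rightarrow> nat \<Rightarrow> real \<Rightarrow> bool" where
  "head_at D i t \<longleftrightarrow> mark D t = Virt i \<and>
     (\<exists>s. s - t \<notin> \<int> \<and> curve D s = curve D t \<and> cross2 (velocity D t) (velocity D s) < 0)"

definition end_sign :: "diagram \<Rightarrow> nat \<Rightarrow> real \<Rightarrow> int" where
  "end_sign D i t = of_bool (tail_at D i t) - of_bool (head_at D i t)"

text \<open>There are no triple points.\<close>

lemma partner_unique:
  assumes "mv_diagram T D" "s - t \<notin> \<int>" "curve D s = curve D t" "u - t \<notin> \<int>" "curve D u = curve D t"
  shows "s - u \<in> \<int>"
proof (rule ccontr)
  assume "s - u \<notin> \<int>"
  moreover have "t - u \<notin> \<int>" using assms(4) by (metis minus_diff_eq minus_in_Ints_iff)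
  ultimately show False using assms unfolding mv_diagram_def by metis
qed

lemma not_tail_and_head:
  assumes D: "mv_diagram T D"
  shows "\<not> (tail_at D i t \<and> head_at D i t)"
proof
  assume "tail_at D i t \<and> head_at D i t"
  then obtain s u where
    "s - t \<notin> \<int>" "curve D s = curve D t" "0 < cross2 (velocity D t) (velocity D s)"
    "u - t \<notin> \<int>" "curve D u = curve D t" "cross2 (velocity D t) (velocity D u) < 0"
    by (auto simp: tail_at_def head_at_def)
  moreover from this have "velocity D s = velocity D u"
    by (intro velocity_cong[OF D] partner_unique[OF D])
  ultimately show False by simp
qed

lemma end_sign_cong:
  assumes D: "mv_diagram T D" and st: "s - t \<in> \<int>"
  shows "end_sign D i s = end_sign D i t"
proof -
  have "u - s \<in> \<int> \<longleftrightarrow> u - t \<in> \<int>" for u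
    using Ints_add[of "u - s" "s - t"] Ints_diff[of "u - t" "s - t"] st by auto
  then show ?thesis
    by (simp add: end_sign_def tail_at_def head_at_def curve_cong[OF D st] mark_cong[OF D st]
        velocity_cong[OF D st])
qed

lemma tail_or_head_if_end_sign: "end_sign D i t \<noteq> 0 \<Longrightarrow> tail_at D i t \<or> head_at D i t"
  by (auto simp: end_sign_def)

lemma double_param_if_end_sign: "end_sign D i t \<noteq> 0 \<Longrightarrow> double_param D t"
  by (drule tail_or_head_if_end_sign) (auto simp: tail_at_def head_at_def double_param_def)

lemma mark_if_end_sign: "end_sign D i t \<noteq> 0 \<Longrightarrow> mark D t = Virt i"
  by (drule tail_or_head_if_end_sign) (auto simp: tail_at_def head_at_def)

lemma finite_double_params:
  assumes D: "mv_diagram T D"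
  shows "finite {t \<in> {0..<1}. double_param D t}"
proof (rule finite_subset)
  show "{t \<in> {0..<1}. double_param D t} \<subseteq> curve D -` crossing_points D \<inter> {0..<1}"
    by (auto simp: crossing_points_def)
  show "finite (curve D -` crossing_points D \<inter> {0..<1})"
  proof (rule finite_finite_vimage_IntI)
    show "finite (crossing_points D)" using D by (simp add: mv_diagram_def)
    \<comment> \<open>Without triple points, at most two parameters of [0, 1) map to p.\<close>
    fix p
    let ?F = "curve D -` {p} \<inter> {0..<1}"
    show "finite ?F"
    proof (cases "\<exists>s\<in>?F. \<exists>t\<in>?F. s \<noteq> t")
      case True
      then obtain s t where st: "s \<in> ?F" "t \<in> ?F" "s \<noteq> t" by blast
      have "?F \<subseteq> {s, t}"
      proof
        fix u assume u: "u \<in> ?F"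
        show "u \<in> {s, t}"
        proof (rule ccontr)
          assume "u \<notin> {s, t}"
          then have "u - t \<notin> \<int>" "s - t \<notin> \<int>"
            using u st diff_in_Ints_Ico[of u t] diff_in_Ints_Ico[of s t] by auto
          then have "s - u \<in> \<int>"
            by (intro partner_unique[OF D]) (use u st in auto)
          then show False using diff_in_Ints_Ico[of s u] u st \<open>u \<notin> {s, t}\<close> by auto
        qed
      qed
      then show ?thesis by (rule finite_subset) simp
    next
      case False
      then have "?F = {} \<or> (\<exists>s. ?F = {s})" by blast
      then show ?thesis by auto
    qed
  qed
qed

lemma circle_chain_end_sign:
  assumes D: "mv_diagram T D"
  shows "circle_chain (end_sign D i)"
  unfolding circle_chain_def
proof
  show "\<forall>t. end_sign D i (t + 1) = end_sign D i t"
    by (intro allI end_sign_cong[OF D]) simp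
  show "finite {t \<in> {0..<1}. end_sign D i t \<noteq> 0}"
    by (rule finite_subset[OF _ finite_double_params[OF D]]) (auto dest: double_param_if_end_sign)
qed

lemma virtual_chords_finite:
  assumes D: "mv_diagram T D"
  shows "finite (virtual_chords D i)"
proof (rule finite_subset)
  let ?E = "{t \<in> {0..<1}. double_param D t}"
  show "virtual_chords D i \<subseteq> ?E \<times> ?E"
  proof
    fix p assume "p \<in> virtual_chords D i"
    then obtain s t where p: "p = (s, t)" "s \<in> {0..<1}" "t \<in> {0..<1}" "s \<noteq> t" "curve D s = curve D t"
      by (auto simp: virtual_chords_def)
    then have "s - t \<notin> \<int>" "t - s \<notin> \<int>" using diff_in_Ints_Ico by blast+
    then show "p \<in> ?E \<times> ?E" using p by (auto simp: double_param_def)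
  qed
  show "finite (?E \<times> ?E)" using finite_double_params[OF D] by simp
qed

lemma virtual_chord_tail_head:
  assumes "(s, t) \<in> virtual_chords D i"
  shows "tail_at D i s" "head_at D i t" "s \<in> {0..<1}" "t \<in> {0..<1}"
proof -
  from assms have st: "s \<in> {0..<1}" "t \<in> {0..<1}" "s \<noteq> t" "curve D s = curve D t"
    "mark D s = Virt i" "mark D t = Virt i" "0 < cross2 (velocity D s) (velocity D t)"
    by (auto simp: virtual_chords_def)
  then have "s - t \<notin> \<int>" "t - s \<notin> \<int>" using diff_in_Ints_Ico by blast+
  then show "tail_at D i s" "head_at D i t" "s \<in> {0..<1}" "t \<in> {0..<1}"
    using st cross2_swap[of "velocity D t" "velocity D s"]
    by (auto simp: tail_at_def head_at_def)
qed

lemma partner_in_Ico: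
  assumes D: "mv_diagram T D" and t: "t \<in> {0..<1}" "mark D t = Virt i"
    and s: "s - t \<notin> \<int>" "curve D s = curve D t"
  shows "frac s \<in> {0..<1}" "frac s \<noteq> t" "curve D (frac s) = curve D t" "mark D (frac s) = Virt i"
    "velocity D (frac s) = velocity D s"
proof -
  note fr = minus_frac_in_Ints(2)[of s]
  show "frac s \<in> {0..<1}" by (simp add: frac_lt_1)
  show "frac s \<noteq> t" using s(1) minus_frac_in_Ints(1)[of s] by auto
  show "curve D (frac s) = curve D t" using curve_cong[OF D fr] s by simp
  have "crossing_marks (mark D s) (mark D t)"
    using D s by (auto simp: mv_diagram_def)
  then show "mark D (frac s) = Virt i"
    using mark_cong[OF D fr] t by (auto simp: crossing_marks_def classical_marks_def virtual_marks_def)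
  show "velocity D (frac s) = velocity D s" by (rule velocity_cong[OF D fr])
qed

lemma fst_virtual_chords:
  assumes D: "mv_diagram T D"
  shows "fst ` virtual_chords D i = {t \<in> {0..<1}. tail_at D i t}"
proof (intro equalityI subsetI)
  fix t assume "t \<in> {t \<in> {0..<1}. tail_at D i t}"
  then obtain s where t: "t \<in> {0..<1}" "mark D t = Virt i" and s: "s - t \<notin> \<int>" "curve D s = curve D t"
    "0 < cross2 (velocity D t) (velocity D s)" by (auto simp: tail_at_def)
  \<comment> \<open>The partner provided by \<open>tail_at\<close> may lie outside [0, 1); its
    fractional part serves as the other end.\<close>
  have "(t, frac s) \<in> virtual_chords D i"
    using partner_in_Ico[OF D t s(1,2)] t s by (auto simp: virtual_chords_def)
  then show "t \<in> fst ` virtual_chords D i" by force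
qed (auto dest: virtual_chord_tail_head)

lemma snd_virtual_chords:
  assumes D: "mv_diagram T D"
  shows "snd ` virtual_chords D i = {t \<in> {0..<1}. head_at D i t}"
proof (intro equalityI subsetI)
  fix t assume "t \<in> {t \<in> {0..<1}. head_at D i t}"
  then obtain s where t: "t \<in> {0..<1}" "mark D t = Virt i" and s: "s - t \<notin> \<int>" "curve D s = curve D t"
    "cross2 (velocity D t) (velocity D s) < 0" by (auto simp: head_at_def)
  have "(frac s, t) \<in> virtual_chords D i"
    using partner_in_Ico[OF D t s(1,2)] t s cross2_swap[of "velocity D s" "velocity D t"]
    by (auto simp: virtual_chords_def)
  then show "t \<in> snd ` virtual_chords D i" by force
qed (auto dest: virtual_chord_tail_head)

lemma inj_on_virtual_chords:
  assumes D: "mv_diagram T D"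
  shows "inj_on fst (virtual_chords D i)" "inj_on snd (virtual_chords D i)"
proof -
  have same: "s = u" if "s \<in> {0..<1}" "t \<in> {0..<1}" "u \<in> {0..<1}" "s \<noteq> t" "u \<noteq> t"
    "curve D s = curve D t" "curve D u = curve D t" for s t u
  proof -
    have "s - t \<notin> \<int>" "u - t \<notin> \<int>" using that diff_in_Ints_Ico by blast+
    then have "s - u \<in> \<int>" using partner_unique[OF D] that by blast
    then show ?thesis using that diff_in_Ints_Ico by blast
  qed
  show "inj_on fst (virtual_chords D i)"
    by (intro inj_onI) (auto simp: virtual_chords_def intro: same)
  show "inj_on snd (virtual_chords D i)"
    by (intro inj_onI) (auto simp: virtual_chords_def intro: same)
qed

text \<open>Turns sums over chords into sums over ends. Each end belongs to one chord of type i and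
  no parameter is both tail and head, so tails and heads together form the support of
  \<open>end_sign D i\<close>.\<close>

lemma sum_virtual_chords:
  assumes D: "mv_diagram T D"
  shows "(\<Sum>p\<in>virtual_chords D i. \<phi> (fst p) - \<phi> (snd p)) =
    (\<Sum>t | t \<in> {0..<1} \<and> end_sign D i t \<noteq> 0. end_sign D i t * \<phi> t)"
proof -
  let ?V = "virtual_chords D i"
  let ?A = "{t \<in> {0..<1}. tail_at D i t}" and ?B = "{t \<in> {0..<1}. head_at D i t}"
  note nth = not_tail_and_head[OF D, of i]
  have fin: "finite ?A" "finite ?B"
    using virtual_chords_finite[OF D, of i]
    unfolding fst_virtual_chords[OF D, symmetric] snd_virtual_chords[OF D, symmetric] by auto
  have "(\<Sum>p\<in>?V. \<phi> (fst p) - \<phi> (snd p)) = (\<Sum>t\<in>?A. \<phi> t) - (\<Sum>t\<in>?B. \<phi> t)"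
    unfolding fst_virtual_chords[OF D, symmetric] snd_virtual_chords[OF D, symmetric]
    by (simp add: sum.reindex inj_on_virtual_chords[OF D] sum_subtractf)
  also have "(\<Sum>t\<in>?A. \<phi> t) = (\<Sum>t\<in>?A. end_sign D i t * \<phi> t)"
    by (rule sum.cong) (use nth in \<open>auto simp: end_sign_def\<close>)
  also have "(\<Sum>t\<in>?B. \<phi> t) = - (\<Sum>t\<in>?B. end_sign D i t * \<phi> t)"
    unfolding sum_negf[symmetric]
    by (rule sum.cong) (use nth in \<open>auto simp: end_sign_def\<close>)
  also have "(\<Sum>t\<in>?A. end_sign D i t * \<phi> t) - - (\<Sum>t\<in>?B. end_sign D i t * \<phi> t) =
      (\<Sum>t\<in>?A \<union> ?B. end_sign D i t * \<phi> t)"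
  proof -
    have "?A \<inter> ?B = {}" using nth by auto
    then show ?thesis
      using sum.union_disjoint[OF fin, of "\<lambda>t. end_sign D i t * \<phi> t"] by linarith
  qed
  also have "?A \<union> ?B = {t \<in> {0..<1}. end_sign D i t \<noteq> 0}"
    using nth by (auto simp: end_sign_def)
  finally show ?thesis by simp
qed

lemma circle_sum_end_sign:
  assumes D: "mv_diagram T D"
  shows "circle_sum (end_sign D i) = 0"
proof -
  have "circle_sum (end_sign D i) = sum (end_sign D i) {t \<in> {0..<1}. end_sign D i t \<noteq> 0}"
    unfolding circle_sum_def
    by (rule sum'_eq_sum) (use circle_chain_end_sign[OF D, of i] in \<open>auto simp: circle_chain_def\<close>)
  \<comment> \<open>With the constant weight 1 every chord contributes 1 - 1.\<close>
  also have "\<dots> = 0" using sum_virtual_chords[OF D, of "\<lambda>_. 1" i] by simp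
  finally show ?thesis .
qed

lemma end_sign_mult_zero: "i \<noteq> j \<Longrightarrow> end_sign D i t * end_sign D j t = 0"
  using mark_if_end_sign[of D i t] mark_if_end_sign[of D j t]
  by (cases "end_sign D i t = 0"; cases "end_sign D j t = 0") auto

text \<open>Twice the intersection number is a sum over all pairs of ends of the product of their
  signs and of \<open>orient\<close>; antisymmetry makes its two halves equal. The type j comes
  first because an end of type j is weighted with the ends of type i before it.\<close>

lemma intersection_number_eq_pairing:
  assumes D: "mv_diagram T D" and ij: "i \<noteq> j"
  shows "intersection_number i j D = pairing (end_sign D j) (end_sign D i)"
proof -
  let ?V = "virtual_chords D i" and ?W = "virtual_chords D j"
  let ?f = "end_sign D i" and ?g = "end_sign D j"
  let ?F = "{t. t \<in> {0..<1} \<and> ?f t \<noteq> 0}" and ?G = "{t. t \<in> {0..<1} \<and> ?g t \<noteq> 0}"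
  note f = circle_chain_end_sign[OF D, of i] and g = circle_chain_end_sign[OF D, of j]
  have "intersection_number i j D = (\<Sum>p\<in>?V. \<Sum>q\<in>?W.
      if chord_segment p \<inter> chord_segment q \<noteq> {} then chord_sign p q else 0)"
  proof -
    have "intersection_number i j D = (\<Sum>(p, q) | (p, q) \<in> ?V \<times> ?W \<and>
               chord_segment p \<inter> chord_segment q \<noteq> {}. chord_sign p q)"
      unfolding intersection_number_def by (rule sum.cong) auto
    also have "\<dots> = (\<Sum>(p, q)\<in>?V \<times> ?W.
        if chord_segment p \<inter> chord_segment q \<noteq> {} then chord_sign p q else 0)"
      by (rule sum.mono_neutral_cong_left) (use virtual_chords_finite[OF D] in \<open>auto split: if_splits\<close>)
    finally show ?thesis by (simp add: sum.cartesian_product)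
  qed
  then have "2 * intersection_number i j D = (\<Sum>p\<in>?V. \<Sum>q\<in>?W.
      2 * (if chord_segment p \<inter> chord_segment q \<noteq> {} then chord_sign p q else 0))"
    by (simp add: sum_distrib_left)
  also have "\<dots> = (\<Sum>p\<in>?V. \<Sum>q\<in>?W. (orient (fst p) (fst q) - orient (snd p) (fst q)) -
      (orient (fst p) (snd q) - orient (snd p) (snd q)))"
  proof (intro sum.cong refl)
    fix p q assume "p \<in> ?V" "q \<in> ?W"
    then obtain a b c d where pq: "p = (a, b)" "q = (c, d)" "(a, b) \<in> ?V" "(c, d) \<in> ?W"
      by (metis surj_pair)
    have "mark D a = Virt i" "mark D b = Virt i" "mark D c = Virt j" "mark D d = Virt j" "a \<noteq> b" "c \<noteq> d"
      using pq by (auto simp: virtual_chords_def)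
    then have "a \<noteq> b" "a \<noteq> c" "a \<noteq> d" "b \<noteq> c" "b \<noteq> d" "c \<noteq> d" using ij by auto
    then show "2 * (if chord_segment p \<inter> chord_segment q \<noteq> {} then chord_sign p q else 0) =
        (orient (fst p) (fst q) - orient (snd p) (fst q)) -
        (orient (fst p) (snd q) - orient (snd p) (snd q))"
      unfolding pq fst_conv snd_conv
      by (intro chord_crossing_sign virtual_chord_tail_head[OF pq(3)] virtual_chord_tail_head[OF pq(4)])
  qed
  \<comment> \<open>\<open>sum_virtual_chords\<close> is applied twice: here to the chords of type j
    for a fixed chord of type i, then to the chords of type i for a fixed end of type j.\<close>
  also have "\<dots> = (\<Sum>p\<in>?V. \<Sum>t\<in>?G. ?g t * (orient (fst p) t - orient (snd p) t))"
    by (intro sum.cong refl sum_virtual_chords[OF D])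
  also have "\<dots> = (\<Sum>t\<in>?G. \<Sum>p\<in>?V. ?g t * orient (fst p) t - ?g t * orient (snd p) t)"
    by (subst sum.swap) (simp add: algebra_simps)
  also have "\<dots> = (\<Sum>t\<in>?G. \<Sum>s\<in>?F. ?f s * (?g t * orient s t))"
    by (intro sum.cong refl sum_virtual_chords[OF D])
  also have "\<dots> = (\<Sum>t\<in>?G. \<Sum>s\<in>?F. ?g t * ?f s * of_bool (s < t)) -
      (\<Sum>t\<in>?G. \<Sum>s\<in>?F. ?f s * ?g t * of_bool (t < s))"
    unfolding sum_subtractf[symmetric]
    by (intro sum.cong refl) (simp add: orient_def)
  also have "(\<Sum>t\<in>?G. \<Sum>s\<in>?F. ?g t * ?f s * of_bool (s < t)) = pairing ?g ?f"
    by (rule pairing_eq_double_sum[OF g f, symmetric])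
  also have "(\<Sum>t\<in>?G. \<Sum>s\<in>?F. ?f s * ?g t * of_bool (t < s)) = pairing ?f ?g"
    unfolding pairing_eq_double_sum[OF f g] by (rule sum.swap)
  also have "pairing ?f ?g = - pairing ?g ?f"
    by (rule pairing_antisym[OF g circle_sum_end_sign[OF D] f end_sign_mult_zero]) (use ij in simp)
  finally show ?thesis by simp
qed

section \<open>Invariance under planar isotopy\<close>

lemma orient_zero_mult: "orient 0 (x * y) = orient 0 x * orient 0 y"
  by (auto simp: orient_def zero_less_mult_iff mult_less_0_iff)

text \<open>Multiplicativity of determinants: \<open>cross2 (L 1) (L \<i>)\<close> is the
  determinant of L in the basis 1, \<i>.\<close>

lemma linear_complex_cross2:
  assumes "linear L"
  shows "cross2 (L v) (L w) = cross2 (L 1) (L \<i>) * cross2 v w"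
proof -
  have L: "L z = Re z *\<^sub>R L 1 + Im z *\<^sub>R L \<i>" for z
  proof -
    have "z = Re z *\<^sub>R 1 + Im z *\<^sub>R \<i>" by (simp add: complex_eq_iff)
    then have "L z = L (Re z *\<^sub>R 1 + Im z *\<^sub>R \<i>)" by simp
    then show ?thesis by (simp only: linear_add[OF assms] linear_scale[OF assms])
  qed
  show ?thesis
    unfolding L[of v] L[of w] by (simp add: cross2_def algebra_simps)
qed

lemma linear_inj_cross2_nonzero:
  assumes L: "linear L" and inj: "inj L"
  shows "cross2 (L 1) (L \<i>) \<noteq> 0"
proof
  let ?p = "L 1" and ?q = "L \<i>"
  assume 0: "cross2 ?p ?q = 0"
  have ker: "a = 0 \<and> b = 0" if "a *\<^sub>R ?p + b *\<^sub>R ?q = 0" for a b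
  proof -
    have "L (a *\<^sub>R 1 + b *\<^sub>R \<i>) = 0"
      using that by (simp only: linear_add[OF L] linear_scale[OF L])
    then have "L (a *\<^sub>R 1 + b *\<^sub>R \<i>) = L 0" using linear_0[OF L] by simp
    then have "a *\<^sub>R 1 + b *\<^sub>R \<i> = 0" using inj by (simp only: inj_eq)
    then show ?thesis by (simp add: complex_eq_iff)
  qed
  \<comment> \<open>A vanishing determinant gives these two relations between the columns; the
    trivial kernel then forces the first column to be zero.\<close>
  have "Re ?q *\<^sub>R ?p + (- Re ?p) *\<^sub>R ?q = 0" "Im ?q *\<^sub>R ?p + (- Im ?p) *\<^sub>R ?q = 0"
    using 0 by (simp_all add: complex_eq_iff cross2_def algebra_simps)
  then have "- Re ?p = 0" "- Im ?p = 0" using ker by blast+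
  then have "?p = 0" by (simp add: complex_eq_iff)
  then show False using ker[of 1 0] by simp
qed

text \<open>The sign of the Jacobian cannot change during the isotopy, which starts at the identity.\<close>

lemma ambient_isotopy_jacobian:
  assumes "ambient_isotopy H"
  obtains L where "\<And>z. (H 1 has_derivative L z) (at z)"
    and "\<And>z. 0 < cross2 (L z 1) (L z \<i>)"
proof -
  from assms obtain H' :: "real \<Rightarrow> complex \<Rightarrow> complex \<Rightarrow>\<^sub>L complex" where
    H0: "H 0 = id" and
    der: "\<And>u z. u \<in> {0..1} \<Longrightarrow> (H u has_derivative blinfun_apply (H' u z)) (at z)" and
    inj: "\<And>u z. u \<in> {0..1} \<Longrightarrow> inj (blinfun_apply (H' u z))" and
    cont: "continuous_on ({0..1} \<times> UNIV) (\<lambda>(u, z). H' u z)"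
    unfolding ambient_isotopy_def by blast
  have "0 < cross2 (H' 1 z 1) (H' 1 z \<i>)" for z
  proof (rule ccontr)
    define \<kappa> where "\<kappa> u = cross2 (H' u z 1) (H' u z \<i>)" for u
    assume "\<not> 0 < cross2 (H' 1 z 1) (H' 1 z \<i>)"
    then have 1: "\<kappa> 1 \<le> 0" by (simp add: \<kappa>_def)
    have "(id has_derivative blinfun_apply (H' 0 z)) (at z)"
      using der[of 0 z] H0 by simp
    moreover have "(id has_derivative id) (at z)" by (rule has_derivative_id)
    ultimately have "blinfun_apply (H' 0 z) = id" by (rule has_derivative_unique)
    then have 0: "0 \<le> \<kappa> 0" by (simp add: \<kappa>_def cross2_def)
    have "continuous_on {0..1} (\<lambda>u. (\<lambda>(u, z). H' u z) (u, z))"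
      by (rule continuous_on_compose2[OF cont]) (auto intro!: continuous_intros)
    then have "continuous_on {0..1} \<kappa>"
      unfolding \<kappa>_def cross2_def by (auto intro!: continuous_intros)
    then obtain u where u: "0 \<le> u" "u \<le> 1" "\<kappa> u = 0"
      using IVT2'[of \<kappa> 1 0 0] 0 1 by auto
    then show False
      using linear_inj_cross2_nonzero[of "blinfun_apply (H' u z)"] inj[of u z]
      by (simp add: \<kappa>_def bounded_linear.linear[OF blinfun.bounded_linear_right])
  qed
  then show thesis using that[of "\<lambda>z. blinfun_apply (H' 1 z)"] der[of 1] by simp
qed

lemma reparametrization_strict_mono:
  assumes "reparametrization \<phi>"
  shows "strict_mono \<phi>" "\<And>t. (\<phi> has_real_derivative deriv \<phi> t) (at t)"
proof -
  show der: "(\<phi> has_real_derivative deriv \<phi> t) (at t)" for t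
    using assms unfolding reparametrization_def C1_differentiable_on_eq
    by (auto simp: DERIV_deriv_iff_real_differentiable)
  show "strict_mono \<phi>"
  proof (rule strict_monoI)
    fix s t :: real assume "s < t"
    then show "\<phi> s < \<phi> t"
      by (rule DERIV_pos_imp_increasing)
        (use der assms in \<open>auto simp: reparametrization_def\<close>)
  qed
qed

lemma reparametrization_add_int:
  assumes "reparametrization \<phi>"
  shows "\<phi> (t + of_int m) = \<phi> t + of_int m"
proof -
  have step: "\<phi> (t + 1) = \<phi> t + 1" for t
    using assms by (simp add: reparametrization_def)
  show ?thesis
  proof (induction m rule: int_induct[where k = 0])
    case (step1 i)
    then show ?case using step[of "t + of_int i"] by (simp add: algebra_simps)
  next
    case (step2 i)
    then show ?case using step[of "t + of_int (i - 1)"] by (simp add: algebra_simps)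
  qed simp
qed

lemma reparametrization_surj:
  assumes "reparametrization \<phi>"
  shows "surj \<phi>"
  unfolding surj_def
proof
  fix y
  \<comment> \<open>y lies between two consecutive integer translates of \<phi> 0.\<close>
  define m where "m = \<lfloor>y - \<phi> 0\<rfloor>"
  have m: "\<phi> (of_int m) \<le> y" "y \<le> \<phi> (of_int (m + 1))"
    using reparametrization_add_int[OF assms, of 0 m] reparametrization_add_int[OF assms, of 0 "m + 1"]
    unfolding m_def by (simp_all add: algebra_simps) linarith+
  have "continuous_on {of_int m..of_int (m + 1)} \<phi>"
    by (rule DERIV_continuous_on) (rule has_field_derivative_at_within[OF reparametrization_strict_mono(2)[OF assms]])
  then obtain x where "\<phi> x = y" using IVT'[of \<phi> "of_int m" y "of_int (m + 1)"] m by auto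
  then show "\<exists>x. y = \<phi> x" by auto
qed

text \<open>By the chain rule the velocities correspond under the differential of
  \<open>H 1\<close>, up to the positive factor coming from \<phi>. This differential has positive
  determinant, so the two velocities at a crossing keep their orientation.\<close>

lemma planar_isotopic_end_sign:
  assumes D: "mv_diagram T D" and D': "mv_diagram T D'" and "planar_isotopic D D'"
  obtains \<phi> where "strict_mono \<phi>" "surj \<phi>" "\<And>t. \<phi> (t + 1) = \<phi> t + (1::real)"
    "\<And>i t. end_sign D' i (\<phi> t) = end_sign D i t"
proof -
  from assms(3) obtain H \<phi> where H: "ambient_isotopy H" and \<phi>: "reparametrization \<phi>"
    and curve: "\<And>t. curve D' (\<phi> t) = H 1 (curve D t)"
    and mark: "\<And>t. double_param D t \<Longrightarrow> mark D' (\<phi> t) = mark D t"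
    unfolding planar_isotopic_def by blast
  obtain L where L: "\<And>z. (H 1 has_derivative L z) (at z)"
    and pos: "\<And>z. 0 < cross2 (L z 1) (L z \<i>)"
    using ambient_isotopy_jacobian[OF H] by metis
  note mono = reparametrization_strict_mono(1)[OF \<phi>]
    and der = reparametrization_strict_mono(2)[OF \<phi>] and surj = reparametrization_surj[OF \<phi>]
  have der_pos: "0 < deriv \<phi> t" for t using \<phi> by (simp add: reparametrization_def)
  have inj: "inj (H 1)" using H by (auto simp: ambient_isotopy_def bij_def)
  have curve_eq: "curve D' (\<phi> s) = curve D' (\<phi> t) \<longleftrightarrow> curve D s = curve D t" for s t
    unfolding curve using inj by (simp add: inj_eq)
  have ints: "\<phi> s - \<phi> t \<in> \<int> \<longleftrightarrow> s - t \<in> \<int>" for s t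
  proof
    assume "s - t \<in> \<int>"
    then obtain m where "s - t = of_int m" by (auto elim: Ints_cases)
    then have "s = t + of_int m" by simp
    then show "\<phi> s - \<phi> t \<in> \<int>" by (simp add: reparametrization_add_int[OF \<phi>])
  next
    assume "\<phi> s - \<phi> t \<in> \<int>"
    then obtain m where "\<phi> s - \<phi> t = of_int m" by (auto elim: Ints_cases)
    then have "\<phi> s = \<phi> (t + of_int m)" by (simp add: reparametrization_add_int[OF \<phi>])
    then have "s = t + of_int m" using strict_mono_eq[OF mono] by blast
    then show "s - t \<in> \<int>" by simp
  qed
  have vel: "deriv \<phi> t *\<^sub>R velocity D' (\<phi> t) = L (curve D t) (velocity D t)" for t
  proof -
    have "((curve D' \<circ> \<phi>) has_vector_derivative deriv \<phi> t *\<^sub>R velocity D' (\<phi> t)) (at t)"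
      by (rule vector_diff_chain_at[OF _ curve_has_velocity[OF D']])
        (use der in \<open>simp add: has_real_derivative_iff_has_vector_derivative\<close>)
    moreover have "((H 1 \<circ> curve D) has_vector_derivative L (curve D t) (velocity D t)) (at t)"
      using vector_derivative_diff_chain_within[OF curve_has_velocity[OF D] has_derivative_at_withinI[OF L]]
      by blast
    moreover have "curve D' \<circ> \<phi> = H 1 \<circ> curve D" using curve by auto
    ultimately show ?thesis by (metis vector_derivative_unique_at)
  qed
  have cross: "deriv \<phi> t * deriv \<phi> s * cross2 (velocity D' (\<phi> t)) (velocity D' (\<phi> s)) =
      cross2 (L (curve D t) 1) (L (curve D t) \<i>) * cross2 (velocity D t) (velocity D s)"
    if "curve D s = curve D t" for s t
  proof -
    have "cross2 (deriv \<phi> t *\<^sub>R velocity D' (\<phi> t)) (deriv \<phi> s *\<^sub>R velocity D' (\<phi> s)) =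
        cross2 (L (curve D t) (velocity D t)) (L (curve D t) (velocity D s))"
      using vel[of s] vel[of t] that by simp
    also have "\<dots> = cross2 (L (curve D t) 1) (L (curve D t) \<i>) * cross2 (velocity D t) (velocity D s)"
      by (rule linear_complex_cross2) (rule has_derivative_linear[OF L])
    finally show ?thesis by (simp add: cross2_simps mult_ac)
  qed
  have sgn: "(0 < cross2 (velocity D' (\<phi> t)) (velocity D' (\<phi> s)) \<longleftrightarrow> 0 < cross2 (velocity D t) (velocity D s)) \<and>
      (cross2 (velocity D' (\<phi> t)) (velocity D' (\<phi> s)) < 0 \<longleftrightarrow> cross2 (velocity D t) (velocity D s) < 0)"
    if "curve D s = curve D t" for s t
  proof -
    have p: "0 < deriv \<phi> t * deriv \<phi> s" using der_pos by simp
    have "0 < p * x \<longleftrightarrow> 0 < x" "p * x < 0 \<longleftrightarrow> x < 0" if "0 < p" for p x :: real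
      using that by (auto simp: zero_less_mult_iff mult_less_0_iff)
    from this[OF p] this[OF pos[of "curve D t"]] show ?thesis
      using cross[OF that] by metis
  qed
  \<comment> \<open>Every partner of \<phi> t has the form \<phi> s, so partners can be sought among
    such parameters.\<close>
  have ex_surj: "(\<exists>s. P s) \<longleftrightarrow> (\<exists>s. P (\<phi> s))" for P
    using surj by (metis surjD)
  have double: "double_param D' (\<phi> t) \<Longrightarrow> double_param D t" for t
    unfolding double_param_def by (subst (asm) ex_surj) (simp add: curve_eq ints)
  have "tail_at D' i (\<phi> t) \<longleftrightarrow> tail_at D i t" for i t
  proof -
    have ex: "(\<exists>s. s - \<phi> t \<notin> \<int> \<and> curve D' s = curve D' (\<phi> t) \<and> 0 < cross2 (velocity D' (\<phi> t)) (velocity D' s)) \<longleftrightarrow>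
        (\<exists>s. s - t \<notin> \<int> \<and> curve D s = curve D t \<and> 0 < cross2 (velocity D t) (velocity D s))"
      by (subst ex_surj) (use curve_eq ints sgn in blast)
    \<comment> \<open>Marks are known to agree only at double points; the existential conjunct
      supplies this.\<close>
    show ?thesis
      unfolding tail_at_def ex using mark[of t, unfolded double_param_def] by metis
  qed
  moreover have "head_at D' i (\<phi> t) \<longleftrightarrow> head_at D i t" for i t
  proof -
    have ex: "(\<exists>s. s - \<phi> t \<notin> \<int> \<and> curve D' s = curve D' (\<phi> t) \<and> cross2 (velocity D' (\<phi> t)) (velocity D' s) < 0) \<longleftrightarrow>
        (\<exists>s. s - t \<notin> \<int> \<and> curve D s = curve D t \<and> cross2 (velocity D t) (velocity D s) < 0)"
      by (subst ex_surj) (use curve_eq ints sgn in blast)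
    show ?thesis
      unfolding head_at_def ex using mark[of t, unfolded double_param_def] by metis
  qed
  ultimately have "end_sign D' i (\<phi> t) = end_sign D i t" for i t
    by (simp add: end_sign_def)
  then show thesis
    using that[of \<phi>] mono surj \<phi> by (auto simp: reparametrization_def)
qed

lemma intersection_number_planar_isotopic:
  assumes D: "mv_diagram T D" and D': "mv_diagram T D'" and iso: "planar_isotopic D D'" and "i \<noteq> j"
  shows "intersection_number i j D' = intersection_number i j D"
proof -
  obtain \<phi> where \<phi>: "strict_mono \<phi>" "surj \<phi>" "\<And>t. \<phi> (t + 1) = \<phi> t + (1::real)"
    "\<And>i t. end_sign D' i (\<phi> t) = end_sign D i t"
    using planar_isotopic_end_sign[OF D D' iso] by metis
  show ?thesis
    unfolding intersection_number_eq_pairing[OF D \<open>i \<noteq> j\<close>] intersection_number_eq_pairing[OF D' \<open>i \<noteq> j\<close>]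
    by (rule pairing_reparametrize[OF \<phi>(1-3)])
      (use \<phi>(4) D D' in \<open>auto intro: circle_chain_end_sign circle_sum_end_sign\<close>)
qed

section \<open>Invariance under local moves\<close>

text \<open>Partners are unique modulo 1, so any one of them decides between tail and head.\<close>

lemma end_sign_partner:
  assumes D: "mv_diagram T D" and s: "s - t \<notin> \<int>" "curve D s = curve D t"
  shows "end_sign D i t = of_bool (mark D t = Virt i) * orient 0 (cross2 (velocity D t) (velocity D s))"
proof -
  have vel: "velocity D u = velocity D s" if "u - t \<notin> \<int>" "curve D u = curve D t" for u
    by (rule velocity_cong[OF D partner_unique[OF D that s]])
  have "tail_at D i t \<longleftrightarrow> mark D t = Virt i \<and> 0 < cross2 (velocity D t) (velocity D s)"
    "head_at D i t \<longleftrightarrow> mark D t = Virt i \<and> cross2 (velocity D t) (velocity D s) < 0"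
    unfolding tail_at_def head_at_def using s vel by metis+
  then show ?thesis by (auto simp: end_sign_def orient_def)
qed

lemma virtual_mark_partner:
  assumes "mv_diagram T D" "s - t \<notin> \<int>" "curve D s = curve D t"
  shows "mark D s = Virt i \<longleftrightarrow> mark D t = Virt i"
proof -
  have "crossing_marks (mark D s) (mark D t)"
    using assms by (auto simp: mv_diagram_def)
  then show ?thesis by (auto simp: crossing_marks_def classical_marks_def virtual_marks_def)
qed

lemma end_sign_partner_minus:
  assumes D: "mv_diagram T D" and s: "s - t \<notin> \<int>" "curve D s = curve D t"
  shows "end_sign D i s = - end_sign D i t"
proof -
  have "t - s \<notin> \<int>" using s(1) by (metis minus_diff_eq minus_in_Ints_iff)
  then show ?thesis
    using end_sign_partner[OF D s, of i] end_sign_partner[OF D, of t s i] s(2)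
      virtual_mark_partner[OF D s, of i] cross2_swap[of "velocity D s" "velocity D t"]
    by (auto simp: orient_def)
qed

lemma not_inner_iff:
  assumes "local_move F F' c e r D D'"
  shows "\<not> inner_param (length F) c r t \<longleftrightarrow> curve D t \<notin> move_square"
    "\<not> inner_param (length F) c r t \<longleftrightarrow> curve D' t \<notin> move_square"
  using assms by (auto simp: local_move_def has_tangle_def)

lemma closed_move_square: "closed move_square"
proof -
  have "move_square = {z. - 1 \<le> Re z} \<inter> {z. Re z \<le> 1} \<inter> {z. - 1 \<le> Im z} \<inter> {z. Im z \<le> 1}"
    by (auto simp: move_square_def)
  moreover have "closed \<dots>"
    by (intro closed_Int closed_halfspace_Re_ge closed_halfspace_Re_le
        closed_halfspace_Im_ge closed_halfspace_Im_le)
  ultimately show ?thesis by simp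
qed

lemma curve_continuous: "mv_diagram T D \<Longrightarrow> continuous_on UNIV (curve D)"
  using curve_has_velocity
  by (meson continuous_at_imp_continuous_on has_vector_derivative_continuous)

text \<open>The square is closed, so the two curves coincide near t.\<close>

lemma velocity_outside:
  assumes D: "mv_diagram T D" and D': "mv_diagram T D'"
    and move: "local_move F F' c e r D D'" and t: "\<not> inner_param (length F) c r t"
  shows "velocity D' t = velocity D t"
proof -
  let ?U = "curve D -` (- move_square)"
  have "open ?U"
    by (rule open_vimage) (use closed_move_square curve_continuous[OF D] in auto)
  moreover have "t \<in> ?U" using t not_inner_iff(1)[OF move] by simp
  moreover have "curve D x = curve D' x" if "x \<in> ?U" for x
    using that move not_inner_iff(1)[OF move, of x] by (auto simp: local_move_def)
  ultimately have "(curve D' has_vector_derivative velocity D t) (at t)"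
    using has_vector_derivative_transform_within_open[OF curve_has_velocity[OF D, of t]] by blast
  then show ?thesis unfolding velocity_def[of D'] by (rule vector_derivative_at)
qed

text \<open>A partner of t maps to the same point outside the square, so both branches of the
  crossing lie where the diagrams agree.\<close>

lemma end_sign_outside:
  assumes D: "mv_diagram T D" and D': "mv_diagram T D'"
    and move: "local_move F F' c e r D D'" and t: "\<not> inner_param (length F) c r t"
  shows "end_sign D' i t = end_sign D i t"
proof -
  have eq: "curve D' s = curve D s" "mark D' s = mark D s" if "\<not> inner_param (length F) c r s" for s
    using move that by (auto simp: local_move_def)
  have partner: "curve D' s = curve D' t \<longleftrightarrow> curve D s = curve D t" for s
    using eq(1)[of s] eq(1)[OF t] t not_inner_iff[OF move, of s] not_inner_iff[OF move, of t] by metis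
  have vel: "velocity D' s = velocity D s" if "curve D s = curve D t" for s
    using velocity_outside[OF D D' move, of s] that not_inner_iff(1)[OF move, of s]
      not_inner_iff(1)[OF move, of t] t by simp
  have "tail_at D' i t \<longleftrightarrow> tail_at D i t" "head_at D' i t \<longleftrightarrow> head_at D i t"
    unfolding tail_at_def head_at_def eq(2)[OF t] partner using vel by metis+
  then show ?thesis by (simp add: end_sign_def)
qed

section \<open>Strand coordinates inside the square\<close>

lemma inner_paramE:
  assumes lay: "strand_layout n c e r" and t: "inner_param n c r t"
  obtains k x where "k < n" "x \<in> {-1..1}" "t - (c k + e k * r * x) \<in> \<int>"
proof -
  obtain k m where km: "k < n" "\<bar>t - c k - of_int m\<bar> \<le> r"
    using t by (auto simp: inner_param_def)
  have r: "0 < r" and e: "e k = 1 \<or> e k = -1" using lay km by (auto simp: strand_layout_def)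
  define x where "x = e k * (t - c k - of_int m) / r"
  have "\<bar>x\<bar> \<le> 1" using km r e by (auto simp: x_def divide_simps)
  moreover have "e k * r * x = t - c k - of_int m" using r e by (auto simp: x_def)
  moreover have "x \<in> {-1..1}" using \<open>\<bar>x\<bar> \<le> 1\<close> by auto
  ultimately show thesis using that[of k x] km by auto
qed

lemma strand_param_diff_in_Ints:
  assumes lay: "strand_layout n c e r" and "k < n" "l < n" "x \<in> {-1..1}" "y \<in> {-1..1}"
    and "(c k + e k * r * x) - (c l + e l * r * y) \<in> \<int>"
  shows "k = l \<and> x = y"
proof -
  have r: "0 < r" and e: "e k = 1 \<or> e k = -1" "e l = 1 \<or> e l = -1"
    using lay assms by (auto simp: strand_layout_def)
  have "\<bar>e k * r * x\<bar> \<le> r" "\<bar>e l * r * y\<bar> \<le> r"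
    using r e assms(4,5) by (auto simp: abs_mult intro: mult_left_le)
  then have "k = l \<and> e k * r * x = e l * r * y"
    using strand_layout_separated[OF lay assms(2,3) _ _ assms(6)] by blast
  then show ?thesis using r e by auto
qed

text \<open>The curve meets the square only along the strands, so the partner of a strand parameter
  lies on a strand as well.\<close>

lemma tangle_double_param:
  assumes D: "mv_diagram T D" and lay: "strand_layout (length F) c e r" and tan: "has_tangle F c e r D"
    and k: "k < length F" "x \<in> {-1..1}" and dbl: "double_param D (c k + e k * r * x)"
  obtains l y where "l < length F" "y \<in> {-1..1}" "(l, y) \<noteq> (k, x)" "(F ! l) y = (F ! k) x"
proof -
  let ?t = "c k + e k * r * x"
  obtain s where s: "s - ?t \<notin> \<int>" "curve D s = curve D ?t"
    using dbl by (auto simp: double_param_def)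
  have r: "0 < r" and e: "e k = 1 \<or> e k = -1" using lay k by (auto simp: strand_layout_def)
  have "\<bar>?t - c k - of_int 0\<bar> \<le> r"
    using r e k(2) by (auto simp: abs_mult intro: mult_left_le)
  then have "inner_param (length F) c r ?t" using k(1) unfolding inner_param_def by blast
  then have "inner_param (length F) c r s" using tan s(2) unfolding has_tangle_def by metis
  then obtain l y where l: "l < length F" "y \<in> {-1..1}" "s - (c l + e l * r * y) \<in> \<int>"
    using inner_paramE[OF lay] by metis
  have "(l, y) \<noteq> (k, x)" using l s by auto
  moreover have "(F ! l) y = (F ! k) x"
    using tan k l s(2) curve_cong[OF D l(3)] by (auto simp: has_tangle_def)
  ultimately show thesis using that l by blast
qed

text \<open>A strand is prescribed only on the closed interval, hence its derivative is that of the
  curve at interior points. The factor is the inverse of \<open>e k * r\<close>, as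
  \<open>e k\<close> is 1 or -1.\<close>

lemma tangle_velocity:
  assumes D: "mv_diagram T D" and lay: "strand_layout (length F) c e r" and tan: "has_tangle F c e r D"
    and k: "k < length F" "x \<in> {-1<..<1}" and der: "((F ! k) has_vector_derivative d) (at x)"
  shows "velocity D (c k + e k * r * x) = (e k / r) *\<^sub>R d"
proof -
  let ?t = "c k + e k * r * x"
  have r: "0 < r" and e: "e k = 1 \<or> e k = -1" using lay k by (auto simp: strand_layout_def)
  have "((\<lambda>x. curve D (c k + e k * r * x)) has_vector_derivative d) (at x)"
    by (rule has_vector_derivative_transform_within_open[OF der, of "{-1<..<1}"])
      (use k tan in \<open>auto simp: has_tangle_def\<close>)
  moreover have "((curve D \<circ> (\<lambda>x. c k + e k * r * x)) has_vector_derivative (e k * r) *\<^sub>R velocity D ?t) (at x)"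
    by (rule vector_diff_chain_at[OF _ curve_has_velocity[OF D]])
      (auto intro!: derivative_eq_intros)
  ultimately have "(e k * r) *\<^sub>R velocity D ?t = d"
    by (simp add: o_def) (metis vector_derivative_unique_at)
  then have "(e k / r) *\<^sub>R d = (e k * e k) *\<^sub>R velocity D ?t" using r by auto
  then show ?thesis using e by auto
qed

text \<open>The positive factor 1 / (r * r) from the speeds does not affect the sign, while
  reversing one of the two strands flips it.\<close>

lemma tangle_end_sign:
  assumes D: "mv_diagram T D" and lay: "strand_layout (length F) c e r" and tan: "has_tangle F c e r D"
    and k: "k < length F" "x \<in> {-1<..<1}" and l: "l < length F" "y \<in> {-1<..<1}"
    and ne: "(l, y) \<noteq> (k, x)" and eq: "(F ! l) y = (F ! k) x"
    and derk: "((F ! k) has_vector_derivative d) (at x)" and derl: "((F ! l) has_vector_derivative d') (at y)"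
  shows "end_sign D i (c k + e k * r * x) =
      of_bool (mark D (c k + e k * r * x) = Virt i) * orient 0 (e k * e l * cross2 d d')"
    and "end_sign D i (c l + e l * r * y) = - end_sign D i (c k + e k * r * x)"
proof -
  let ?t = "c k + e k * r * x" and ?s = "c l + e l * r * y"
  have r: "0 < r" using lay by (simp add: strand_layout_def)
  have s: "?s - ?t \<notin> \<int>"
    using strand_param_diff_in_Ints[OF lay l(1) k(1), of y x] k l ne by auto
  have c: "curve D ?s = curve D ?t"
    using tan k l eq by (auto simp: has_tangle_def)
  have "cross2 (velocity D ?t) (velocity D ?s) = (e k * e l * cross2 d d') * (1 / (r * r))"
    unfolding tangle_velocity[OF D lay tan k derk] tangle_velocity[OF D lay tan l derl]
    by (simp add: cross2_simps)
  moreover have "orient 0 (1 / (r * r)) = 1" using r by (simp add: orient_def)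
  ultimately show "end_sign D i ?t = of_bool (mark D ?t = Virt i) * orient 0 (e k * e l * cross2 d d')"
    using end_sign_partner[OF D s c, of i] by (simp only: orient_zero_mult[of "e k * e l * cross2 d d'"] mult_1_right)
  show "end_sign D i ?s = - end_sign D i ?t" by (rule end_sign_partner_minus[OF D s c])
qed

lemma sum'_strand:
  fixes h :: "real \<Rightarrow> int"
  assumes e: "e = 1 \<or> e = -1" and r: "0 < r" and X: "finite X" "X \<subseteq> {-1..1}"
    and zero: "\<And>x. x \<in> {-1..1} - X \<Longrightarrow> h (c + e * r * x) = 0"
  shows "sum' h {c - r..c + r} = (\<Sum>x\<in>X. h (c + e * r * x))"
proof -
  let ?g = "\<lambda>x. c + e * r * x"
  have inj: "inj_on ?g X" using e r by (auto simp: inj_on_def)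
  have "sum' h {c - r..c + r} = sum h (?g ` X)"
  proof (rule sum'_eq_sum)
    show "finite (?g ` X)" using X by simp
    show "?g ` X \<subseteq> {c - r..c + r}"
    proof
      fix t assume "t \<in> ?g ` X"
      then obtain x where x: "x \<in> {-1..1}" "t = ?g x" using X by auto
      have "\<bar>e * r * x\<bar> \<le> r" using r e x by (auto simp: abs_mult intro: mult_left_le)
      then show "t \<in> {c - r..c + r}" using x by auto
    qed
    fix t assume t: "t \<in> {c - r..c + r} - ?g ` X"
    define x where "x = e * (t - c) / r"
    have x: "?g x = t" using e r by (auto simp: x_def)
    have "\<bar>x\<bar> \<le> 1" using t r e by (auto simp: x_def divide_simps)
    then have "x \<in> {-1..1}" by auto
    then show "h t = 0" using zero[of x] t x by (auto simp: image_iff)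
  qed
  also have "\<dots> = (\<Sum>x\<in>X. h (?g x))" by (simp add: sum.reindex[OF inj])
  finally show ?thesis .
qed

lemma primitive_strand_const:
  assumes g: "circle_chain g" and e: "e = 1 \<or> e = -1" and r: "0 < r"
    and zero: "\<And>x. x \<in> {-1..1} \<Longrightarrow> g (c + e * r * x) = 0" and x: "x \<in> {-1..1}"
  shows "primitive g (c + e * r * x) = primitive g (c - r)"
proof (rule primitive_const[OF g])
  have "\<bar>e * r * x\<bar> \<le> r" using r e x by (auto simp: abs_mult intro: mult_left_le)
  then show "c - r \<le> c + e * r * x" by auto
  fix t assume t: "t \<in> {c - r..<c + e * r * x}"
  define y where "y = e * (t - c) / r"
  have y: "c + e * r * y = t" using e r by (auto simp: y_def)
  have "\<bar>y\<bar> \<le> 1" using t r e \<open>\<bar>e * r * x\<bar> \<le> r\<close> by (auto simp: y_def divide_simps)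
  then have "y \<in> {-1..1}" by auto
  then show "g t = 0" using zero[of y] y by auto
qed

text \<open>Between the two parameters g is nonzero at c at most. For e = -1 the strand runs against
  the orientation of the circle, and passing c subtracts the value.\<close>

lemma primitive_strand_jump:
  assumes g: "circle_chain g" and e: "e = 1 \<or> e = -1" and r: "0 < r"
    and zero: "\<And>x. x \<in> {-1..1} - {0} \<Longrightarrow> g (c + e * r * x) = 0" and a: "0 < a" "a < 1"
  shows "primitive g (c + e * r * a) = primitive g (c + e * r * (- a)) + orient 0 e * g c"
proof -
  have sum: "sum' g {c - r * a..<c + r * a} = sum g {c}"
  proof (rule sum'_eq_sum)
    show "{c} \<subseteq> {c - r * a..<c + r * a}" using r a by simp
    fix t assume t: "t \<in> {c - r * a..<c + r * a} - {c}"
    define y where "y = e * (t - c) / r"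
    have y: "c + e * r * y = t" using e r by (auto simp: y_def)
    have "\<bar>t - c\<bar> \<le> r * a" using t by auto
    also have "\<dots> \<le> r * 1" using r a by (intro mult_left_mono) auto
    finally have "\<bar>y\<bar> \<le> 1" using r e by (auto simp: y_def divide_simps abs_mult)
    then have "y \<in> {-1..1}" by auto
    moreover have "y \<noteq> 0" using t y by auto
    ultimately show "g t = 0" using zero[of y] y by auto
  qed simp
  have "primitive g (c + r * a) = primitive g (c - r * a) + g c"
    using primitive_diff[OF g, of "c - r * a" "c + r * a"] sum r a by simp
  then show ?thesis using e by (auto simp: orient_def)
qed

lemma end_sign_eqI:
  assumes D: "mv_diagram T D" and D': "mv_diagram T D'" and move: "local_move F F' c e r D D'"
    and inner: "\<And>k x. k < length F \<Longrightarrow> x \<in> {-1..1} \<Longrightarrow>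
      end_sign D' j (c k + e k * r * x) = end_sign D j (c k + e k * r * x)"
  shows "end_sign D' j = end_sign D j"
proof
  fix t
  show "end_sign D' j t = end_sign D j t"
  proof (cases "inner_param (length F) c r t")
    case True
    have lay: "strand_layout (length F) c e r" using move by (simp add: local_move_def)
    obtain k x where kx: "k < length F" "x \<in> {-1..1}" "t - (c k + e k * r * x) \<in> \<int>"
      using inner_paramE[OF lay True] by metis
    then show ?thesis
      using inner[OF kx(1,2)] end_sign_cong[OF D kx(3)] end_sign_cong[OF D' kx(3)] by simp
  qed (rule end_sign_outside[OF D D' move])
qed

text \<open>\<open>X k\<close> collects the coordinates on strand k at which the chain of type i may
  change; the chain of type j enters with its values before the move.\<close>

lemma pairing_local_move:
  assumes D: "mv_diagram T D" and D': "mv_diagram T D'" and move: "local_move F F' c e r D D'"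
    and X: "\<And>k. k < length F \<Longrightarrow> finite (X k)" "\<And>k. k < length F \<Longrightarrow> X k \<subseteq> {-1..1}"
    and zero: "\<And>k x. k < length F \<Longrightarrow> x \<in> {-1..1} - X k \<Longrightarrow>
      end_sign D' i (c k + e k * r * x) = end_sign D i (c k + e k * r * x)"
  shows "pairing (end_sign D' i) (end_sign D j) = pairing (end_sign D i) (end_sign D j) +
    (\<Sum>k<length F. \<Sum>x\<in>X k. (end_sign D' i (c k + e k * r * x) - end_sign D i (c k + e k * r * x)) *
        primitive (end_sign D j) (c k + e k * r * x))"
proof -
  have lay: "strand_layout (length F) c e r" using move by (simp add: local_move_def)
  have "(\<Sum>k<length F. sum' (\<lambda>s. (end_sign D' i s - end_sign D i s) * primitive (end_sign D j) s) {c k - r..c k + r}) =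
    (\<Sum>k<length F. \<Sum>x\<in>X k. (end_sign D' i (c k + e k * r * x) - end_sign D i (c k + e k * r * x)) *
        primitive (end_sign D j) (c k + e k * r * x))"
    by (intro sum.cong refl sum'_strand) (use lay X zero in \<open>auto simp: strand_layout_def\<close>)
  then show ?thesis
    using pairing_local_change[OF lay circle_chain_end_sign[OF D] circle_chain_end_sign[OF D']
        circle_chain_end_sign[OF D] circle_sum_end_sign[OF D] end_sign_outside[OF D D' move]]
    by simp
qed

text \<open>Here \<open>\<mu>\<close> is the mark of the moving strand: a local move changes only the chain of the type
  of \<open>\<mu>\<close>. The case where this is the second type follows by antisymmetry of the pairing.\<close>

lemma intersection_number_local_move:
  assumes D: "mv_diagram T D" and D': "mv_diagram T D'" and ij: "i \<noteq> j"
    and eq: "\<And>j. \<mu> \<noteq> Virt j \<Longrightarrow> end_sign D' j = end_sign D j"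
    and pair: "\<And>i j. i \<noteq> j \<Longrightarrow> \<mu> \<noteq> Virt j \<Longrightarrow>
      pairing (end_sign D' i) (end_sign D j) = pairing (end_sign D i) (end_sign D j)"
  shows "intersection_number i j D' = intersection_number i j D"
proof -
  have anti: "pairing (end_sign E j) (end_sign E i) = - pairing (end_sign E i) (end_sign E j)"
    if "mv_diagram T E" for E
    using circle_chain_end_sign[OF that] circle_sum_end_sign[OF that] end_sign_mult_zero[OF ij]
    by (intro pairing_antisym) auto
  show ?thesis
    unfolding intersection_number_eq_pairing[OF D ij] intersection_number_eq_pairing[OF D' ij]
  proof (cases "\<mu> = Virt i")
    case True
    then have "\<mu> \<noteq> Virt j" using ij by simp
    then show "pairing (end_sign D' j) (end_sign D' i) = pairing (end_sign D j) (end_sign D i)"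
      using anti[OF D] anti[OF D'] eq[of j] pair[of i j] ij by simp
  next
    case False
    then show "pairing (end_sign D' j) (end_sign D' i) = pairing (end_sign D j) (end_sign D i)"
      using eq[of i] pair[of j i] ij by simp
  qed
qed

lemma tangle_end_sign_zero:
  assumes D: "mv_diagram T D" and lay: "strand_layout (length F) c e r" and tan: "has_tangle F c e r D"
    and k: "k < length F" "x \<in> {-1..1}"
    and simple: "\<And>l y. l < length F \<Longrightarrow> (F ! l) y = (F ! k) x \<Longrightarrow> y \<in> {-1..1} \<Longrightarrow> (l, y) = (k, x)"
  shows "end_sign D i (c k + e k * r * x) = 0"
  using tangle_double_param[OF D lay tan k] double_param_if_end_sign[of D i] simple by metis

lemma end_sign_zero_if_mark: "mark D t \<noteq> Virt i \<Longrightarrow> end_sign D i t = 0"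
  using mark_if_end_sign by blast

text \<open>If the second chain vanishes on a strand, its primitive is constant there, and only the
  total change of the first chain on this strand counts. This settles the first two moves.\<close>

lemma pairing_local_move_const:
  assumes D: "mv_diagram T D" and D': "mv_diagram T D'" and move: "local_move F F' c e r D D'"
    and X: "\<And>k. k < length F \<Longrightarrow> finite (X k)" "\<And>k. k < length F \<Longrightarrow> X k \<subseteq> {-1..1}"
    and zero: "\<And>k x. k < length F \<Longrightarrow> x \<in> {-1..1} - X k \<Longrightarrow>
      end_sign D' i (c k + e k * r * x) = end_sign D i (c k + e k * r * x)"
    and g: "\<And>k x. k < length F \<Longrightarrow> x \<in> {-1..1} \<Longrightarrow> end_sign D j (c k + e k * r * x) = 0"
    and sums: "\<And>k. k < length F \<Longrightarrow>
      (\<Sum>x\<in>X k. end_sign D' i (c k + e k * r * x)) = (\<Sum>x\<in>X k. end_sign D i (c k + e k * r * x))"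
  shows "pairing (end_sign D' i) (end_sign D j) = pairing (end_sign D i) (end_sign D j)"
proof -
  have lay: "strand_layout (length F) c e r" using move by (simp add: local_move_def)
  have "(\<Sum>x\<in>X k. (end_sign D' i (c k + e k * r * x) - end_sign D i (c k + e k * r * x)) *
      primitive (end_sign D j) (c k + e k * r * x)) = 0" if k: "k < length F" for k
  proof -
    have "primitive (end_sign D j) (c k + e k * r * x) = primitive (end_sign D j) (c k - r)"
      if "x \<in> X k" for x
      by (rule primitive_strand_const[OF circle_chain_end_sign[OF D] _ _ g[OF k] subsetD[OF X(2)[OF k] that]])
        (use lay k in \<open>auto simp: strand_layout_def\<close>)
    then have "(\<Sum>x\<in>X k. (end_sign D' i (c k + e k * r * x) - end_sign D i (c k + e k * r * x)) *
      primitive (end_sign D j) (c k + e k * r * x)) =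
      (\<Sum>x\<in>X k. end_sign D' i (c k + e k * r * x) - end_sign D i (c k + e k * r * x)) *
      primitive (end_sign D j) (c k - r)"
      by (simp add: sum_distrib_right)
    then show ?thesis using sums[OF k] by (simp add: sum_subtractf)
  qed
  moreover have "pairing (end_sign D' i) (end_sign D j) = pairing (end_sign D i) (end_sign D j) +
    (\<Sum>k<length F. \<Sum>x\<in>X k. (end_sign D' i (c k + e k * r * x) - end_sign D i (c k + e k * r * x)) *
        primitive (end_sign D j) (c k + e k * r * x))"
    by (rule pairing_local_move[OF D D' move]) (fact X zero)+
  ultimately show ?thesis by simp
qed

section \<open>The functions of the normal forms and the positions of their crossings\<close>

lemma has_vector_derivative_graph:
  assumes "(f has_real_derivative f') (at x)"
  shows "((\<lambda>x. Complex x (f x)) has_vector_derivative Complex 1 f') (at x)"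
proof -
  have "((\<lambda>x. of_real x + \<i> * of_real (f x)) has_vector_derivative (of_real 1 + \<i> * of_real f')) (at x)"
    by (intro has_vector_derivative_add has_vector_derivative_mult_right has_vector_derivative_of_real
        assms DERIV_ident)
  then show ?thesis by (simp add: Complex_eq)
qed

lemma bump_deriv: "(bump has_real_derivative - 4 * x * (1 - x\<^sup>2)) (at x)"
  unfolding bump_def[abs_def] by (auto intro!: derivative_eq_intros simp: algebra_simps)

lemma bump_minus [simp]: "bump (- x) = bump x"
  by (simp add: bump_def)

lemma bump_nonneg: "0 \<le> bump x"
  by (simp add: bump_def)

lemma bump_eqD:
  assumes "bump x = bump y" "x \<in> {-1..1}" "y \<in> {-1..1}"
  shows "x = y \<or> x = - y"
proof -
  have "0 \<le> 1 - x\<^sup>2" "0 \<le> 1 - y\<^sup>2" using assms by (auto simp: abs_square_le_1)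
  with assms(1)[unfolded bump_def] have "1 - x\<^sup>2 = 1 - y\<^sup>2" by (rule power2_eq_imp_eq)
  then show ?thesis by (simp add: power2_eq_iff)
qed

lemma bump_continuous: "continuous_on A bump"
  unfolding bump_def[abs_def] by (intro continuous_intros)

text \<open>The strands of the second move cross at the coordinates a and -a.\<close>

lemma bump_halfE:
  obtains a where "0 < a" "a < 1" "bump a = 1 / 2"
proof -
  obtain a where a: "0 \<le> a" "a \<le> 1" "bump a = 1 / 2"
    using IVT2'[of bump 1 "1 / 2" 0] bump_continuous by (auto simp: bump_def)
  then have "a \<noteq> 0" "a \<noteq> 1" by (auto simp: bump_def)
  then show thesis using that[of a] a by simp
qed

text \<open>In the third move the strand at height \<open>bump x / 2\<close> meets the line of
  height \<open>x / 2\<close> at x = a. Uniqueness holds since \<open>bump\<close> decreases on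
  [0, 1] while the identity increases, and since \<open>bump\<close> is nonnegative.\<close>

lemma bump_fixE:
  obtains a where "0 < a" "a < 1" "bump a = a" "\<And>x. x \<in> {-1..1} \<Longrightarrow> bump x = x \<Longrightarrow> x = a"
proof -
  have "continuous_on {0..1} (\<lambda>x. bump x - x)"
    by (intro continuous_intros bump_continuous)
  moreover have "bump 1 - 1 \<le> 0" "0 \<le> bump 0 - 0" by (simp_all add: bump_def)
  ultimately obtain a where "0 \<le> a" "a \<le> 1" "bump a - a = 0"
    using IVT2'[of "\<lambda>x. bump x - x" 1 0 0] by auto
  then have a: "0 \<le> a" "a \<le> 1" "bump a = a" by auto
  have less: False if "0 \<le> x" "x < y" "y \<le> 1" "bump x = x" "bump y = y" for x y
  proof -
    have "x\<^sup>2 \<le> y\<^sup>2" "y\<^sup>2 \<le> 1" using that by (auto intro: power_mono simp: power_le_one)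
    then have "bump y \<le> bump x" unfolding bump_def by (intro power_mono) auto
    then show False using that by simp
  qed
  have "x = a" if "x \<in> {-1..1}" "bump x = x" for x
  proof -
    have "0 \<le> x" using bump_nonneg[of x] that by simp
    then show ?thesis using less[of x a] less[of a x] a that by (cases x a rule: linorder_cases) auto
  qed
  moreover have "a \<noteq> 0" "a \<noteq> 1" using a by (auto simp: bump_def)
  ultimately show thesis using that[of a] a by simp
qed

text \<open>Equal heights give y = -x. The abscissa is odd in x, so it has to vanish, which means
  that \<open>bump x\<close> is 1 / 4.\<close>

lemma kink_eqD:
  assumes "kink x = kink y" "x \<in> {-1..1}" "y \<in> {-1..1}" "x \<noteq> y"
  shows "y = - x" "\<bar>x\<bar> = sqrt (1 / 2)"
proof -
  have "x * (1 - 4 * bump x) = y * (1 - 4 * bump y) \<and> bump x / 2 = bump y / 2"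
    using assms(1) unfolding kink_def complex.inject .
  then have eq: "bump x = bump y" "x * (1 - 4 * bump x) = y * (1 - 4 * bump y)" by linarith+
  show y: "y = - x" using bump_eqD[OF eq(1) assms(2,3)] assms(4) by auto
  then have "x * (1 - 4 * bump x) = 0" using eq(2) by simp
  then have "bump x = (1 / 2)\<^sup>2" using y assms(4) by (auto simp: power2_eq_square)
  then have "(1 - x\<^sup>2)\<^sup>2 = (1 / 2)\<^sup>2" by (simp only: bump_def)
  moreover have "0 \<le> 1 - x\<^sup>2" using assms(2) by (auto simp: abs_square_le_1)
  ultimately have "1 - x\<^sup>2 = 1 / 2" by (rule power2_eq_imp_eq) simp
  then have "x\<^sup>2 = 1 / 2" by simp
  then have "sqrt (x\<^sup>2) = sqrt (1 / 2)" by (simp only:)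
  then show "\<bar>x\<bar> = sqrt (1 / 2)" by (simp only: real_sqrt_abs)
qed

section \<open>Invariance under each of the moves\<close>

lemma virtual_crossing_marks: "crossing_marks \<mu> \<nu> \<Longrightarrow> \<nu> = Virt i \<longleftrightarrow> \<mu> = Virt i"
  by (auto simp: crossing_marks_def classical_marks_def virtual_marks_def)

text \<open>The kink adds one crossing whose two ends lie on the same strand, with opposite signs if
  it is virtual.\<close>

lemma intersection_number_omega1:
  assumes D: "mv_diagram T D" and D': "mv_diagram T D'" and om: "omega1 D D'" and ij: "i \<noteq> j"
  shows "intersection_number i j D' = intersection_number i j D"
proof -
  let ?F = "[\<lambda>x. Complex x 0]"
  obtain c e r \<mu> \<nu> where move: "local_move ?F [kink] c e r D D'"
    and cm: "crossing_marks \<mu> \<nu>"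
    and mk: "\<And>x. x \<in> {-1..1} \<Longrightarrow> mark D' (c 0 + e 0 * r * x) = (if x < 0 then \<mu> else \<nu>)"
    using om unfolding omega1_def by blast
  have lay: "strand_layout (length ?F) c e r" "strand_layout (length [kink]) c e r"
    and tan: "has_tangle ?F c e r D" "has_tangle [kink] c e r D'"
    using move by (auto simp: local_move_def)
  have zero: "end_sign D i (c 0 + e 0 * r * x) = 0" if "x \<in> {-1..1}" for i x
    by (rule tangle_end_sign_zero[OF D lay(1) tan(1)]) (use that in auto)
  have zero': "end_sign D' j (c 0 + e 0 * r * x) = 0" if "x \<in> {-1..1}" "\<mu> \<noteq> Virt j" for j x
    by (rule end_sign_zero_if_mark) (use mk that virtual_crossing_marks[OF cm] in auto)
  define a where "a = sqrt (1 / 2)"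
  have a: "0 < a" "a < 1" by (auto simp: a_def)
  have supp: "end_sign D' i (c 0 + e 0 * r * x) = 0" if "x \<in> {-1..1} - {a, - a}" for i x
  proof (rule tangle_end_sign_zero[OF D' lay(2) tan(2)])
    fix l y assume "l < length [kink]" "([kink] ! l) y = ([kink] ! 0) x" "y \<in> {-1..1}"
    then have "l = 0" "kink y = kink x" "y \<in> {-1..1}" by auto
    moreover have "\<bar>x\<bar> \<noteq> a" using that by auto
    ultimately show "(l, y) = (0, x)" using kink_eqD(2)[of x y] that unfolding a_def by auto
  qed (use that in auto)
  have curve: "curve D' (c 0 + e 0 * r * x) = kink x" if "x \<in> {-1..1}" for x
    using tan(2) that by (auto simp: has_tangle_def)
  have "kink a = kink (- a)"
  proof -
    have "bump a = 1 / 4" by (simp add: bump_def a_def power2_eq_square)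
    then show ?thesis by (simp add: kink_def)
  qed
  moreover have "(c 0 + e 0 * r * a) - (c 0 + e 0 * r * (- a)) \<notin> \<int>"
    using strand_param_diff_in_Ints[OF lay(2), of 0 0 a "- a"] a by auto
  ultimately have cancel: "end_sign D' i (c 0 + e 0 * r * a) = - end_sign D' i (c 0 + e 0 * r * (- a))" for i
    by (intro end_sign_partner_minus[OF D']) (use curve[of a] curve[of "- a"] a in auto)
  show ?thesis
  proof (rule intersection_number_local_move[OF D D' ij, of \<mu>])
    fix j assume j: "\<mu> \<noteq> Virt j"
    show "end_sign D' j = end_sign D j"
      by (rule end_sign_eqI[OF D D' move]) (use zero zero' j in simp)
    fix i assume "i \<noteq> j"
    show "pairing (end_sign D' i) (end_sign D j) = pairing (end_sign D i) (end_sign D j)"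
      by (rule pairing_local_move_const[OF D D' move, where X = "\<lambda>_. {a, - a}"])
        (use a zero zero[of a i] zero[of "- a" i] supp cancel[of i] in auto)
  qed
qed

text \<open>Each strand acquires two ends. The relative slope of the strands is odd in x, so the
  ends at a and -a on one strand have opposite signs.\<close>

lemma intersection_number_omega2:
  assumes D: "mv_diagram T D" and D': "mv_diagram T D'" and om: "omega2 D D'" and ij: "i \<noteq> j"
  shows "intersection_number i j D' = intersection_number i j D"
proof -
  let ?F = "[\<lambda>x. Complex x 0, \<lambda>x. Complex x (1 / 2)]"
  let ?F' = "[\<lambda>x. Complex x 0, \<lambda>x. Complex x (1 / 2 - bump x)]"
  obtain c e r \<mu> \<nu> where move: "local_move ?F ?F' c e r D D'"
    and cm: "crossing_marks \<mu> \<nu>"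
    and mk: "\<And>x. x \<in> {-1..1} \<Longrightarrow> mark D' (c 0 + e 0 * r * x) = \<mu>"
      "\<And>x. x \<in> {-1..1} \<Longrightarrow> mark D' (c 1 + e 1 * r * x) = \<nu>"
    using om unfolding omega2_def by blast
  have lay: "strand_layout (length ?F) c e r" "strand_layout (length ?F') c e r"
    and tan: "has_tangle ?F c e r D" "has_tangle ?F' c e r D'"
    using move by (auto simp: local_move_def)
  have zero: "end_sign D i (c k + e k * r * x) = 0" if "k < length ?F" "x \<in> {-1..1}" for i k x
    by (rule tangle_end_sign_zero[OF D lay(1) tan(1)])
      (use that in \<open>auto simp: less_Suc_eq\<close>)
  have zero': "end_sign D' j (c k + e k * r * x) = 0"
    if "k < length ?F" "x \<in> {-1..1}" "\<mu> \<noteq> Virt j" for j k x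
  proof (rule end_sign_zero_if_mark)
    have "k = 0 \<or> k = 1" using that(1) by auto
    then show "mark D' (c k + e k * r * x) \<noteq> Virt j"
      using mk that virtual_crossing_marks[OF cm] by auto
  qed
  obtain a where a: "0 < a" "a < 1" "bump a = 1 / 2" by (rule bump_halfE)
  have root: "x = a \<or> x = - a" if "x \<in> {-1..1}" "bump x = 1 / 2" for x
    using bump_eqD[of x a] a that by simp
  have supp: "end_sign D' i (c k + e k * r * x) = 0"
    if "k < length ?F" "x \<in> {-1..1} - {a, - a}" for i k x
  proof -
    have "bump x \<noteq> 1 / 2" using root[of x] that(2) by blast
    then show ?thesis
      by (intro tangle_end_sign_zero[OF D' lay(2) tan(2)])
        (use that in \<open>auto simp: less_Suc_eq\<close>)
  qed
  have der: "((?F' ! 0) has_vector_derivative Complex 1 0) (at x)"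
    "((?F' ! 1) has_vector_derivative Complex 1 (4 * x * (1 - x\<^sup>2))) (at x)" for x
    by (auto intro!: has_vector_derivative_graph derivative_eq_intros bump_deriv)
  have strand0: "end_sign D' i (c 0 + e 0 * r * x) =
      of_bool (\<mu> = Virt i) * orient 0 (e 0 * e 1 * (4 * x * (1 - x\<^sup>2)))"
    and strand1: "end_sign D' i (c 1 + e 1 * r * x) = - end_sign D' i (c 0 + e 0 * r * x)"
    if "x = a \<or> x = - a" for i x
    using tangle_end_sign[OF D' lay(2) tan(2) _ _ _ _ _ _ der(1)[of x] der(2)[of x], of i] that a mk(1)[of x]
    by (auto simp: cross2_def)
  have cancel: "end_sign D' i (c 0 + e 0 * r * (- a)) = - end_sign D' i (c 0 + e 0 * r * a)" for i
    using strand0[of a i] strand0[of "- a" i] by (auto simp: orient_def)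
  show ?thesis
  proof (rule intersection_number_local_move[OF D D' ij, of \<mu>])
    fix j assume j: "\<mu> \<noteq> Virt j"
    show "end_sign D' j = end_sign D j"
      by (rule end_sign_eqI[OF D D' move]) (use zero zero' j in simp)
    fix i assume "i \<noteq> j"
    show "pairing (end_sign D' i) (end_sign D j) = pairing (end_sign D i) (end_sign D j)"
    proof (rule pairing_local_move_const[OF D D' move, where X = "\<lambda>_. {a, - a}"])
      fix k assume k: "k < length ?F"
      then have "k = 0 \<or> k = 1" by auto
      then have "(\<Sum>x\<in>{a, - a}. end_sign D' i (c k + e k * r * x)) = 0"
        using cancel[of i] strand1[of a i] strand1[of "- a" i] a by auto
      moreover have "(\<Sum>x\<in>{a, - a}. end_sign D i (c k + e k * r * x)) = 0"
        using zero[OF k, of a i] zero[OF k, of "- a" i] a by simp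
      ultimately show "(\<Sum>x\<in>{a, - a}. end_sign D' i (c k + e k * r * x)) =
          (\<Sum>x\<in>{a, - a}. end_sign D i (c k + e k * r * x))" by simp
    qed (use a zero supp in auto)
  qed
qed

text \<open>The crossing of strands 1 and 2 keeps its parameters and signs. The ends on strand 0
  exchange places, the end on strand 1 moves from a to -a, and the end on strand 2 from -a to
  a.\<close>

lemma intersection_number_slide:
  assumes D: "mv_diagram T D" and D': "mv_diagram T D'" and sl: "slide \<mu> \<nu> \<kappa> \<kappa>' D D'"
    and cm: "crossing_marks \<mu> \<nu>" "crossing_marks \<kappa> \<kappa>'" and ij: "i \<noteq> j"
  shows "intersection_number i j D' = intersection_number i j D"
proof -
  let ?F = "[\<lambda>x. Complex x (bump x / 2), \<lambda>x. Complex x (x / 2), \<lambda>x. Complex x (- x / 2)]"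
  let ?F' = "[\<lambda>x. Complex x (- bump x / 2), \<lambda>x. Complex x (x / 2), \<lambda>x. Complex x (- x / 2)]"
  obtain c e r where move: "local_move ?F ?F' c e r D D'"
    and mk: "\<And>E x. E \<in> {D, D'} \<Longrightarrow> x \<in> {-1..1} \<Longrightarrow>
           mark E (c 0 + e 0 * r * x) = \<mu> \<and>
           mark E (c 1 + e 1 * r * x) = (if x = 0 then \<kappa> else \<nu>) \<and>
           mark E (c 2 + e 2 * r * x) = (if x = 0 then \<kappa>' else \<nu>)"
    using sl unfolding slide_def by blast
  have lay: "strand_layout (length ?F) c e r" "strand_layout (length ?F') c e r"
    and tan: "has_tangle ?F c e r D" "has_tangle ?F' c e r D'"
    using move by (auto simp: local_move_def)
  have r: "0 < r" and e: "e 0 = 1 \<or> e 0 = -1" "e 1 = 1 \<or> e 1 = -1" "e 2 = 1 \<or> e 2 = -1"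
    using lay(1) by (auto simp: strand_layout_def)
  obtain a where a: "0 < a" "a < 1" "bump a = a"
    and root: "\<And>x. x \<in> {-1..1} \<Longrightarrow> bump x = x \<Longrightarrow> x = a"
    using bump_fixE by metis
  have root': "x = - a" if "x \<in> {-1..1}" "bump x = - x" for x
    using root[of "- x"] that by auto
  have strands: "k = 0 \<or> k = 1 \<or> k = 2" if "k < length ?F" for k
    using that by auto
  have supp: "end_sign E i (c k + e k * r * x) = 0"
    if E: "E \<in> {D, D'}" and k: "k < length ?F" and x: "x \<in> {-1..1} - {a, - a, 0}" for E i k x
  proof -
    have x': "x \<in> {-1..1}" "x \<noteq> 0" "bump x \<noteq> x" "bump x \<noteq> - x" "- bump x \<noteq> x"
      using x root[of x] root'[of x] by auto
    have "end_sign D i (c k + e k * r * x) = 0"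
      by (rule tangle_end_sign_zero[OF D lay(1) tan(1) k x'(1)])
        (use k x' in \<open>auto simp: less_Suc_eq\<close>)
    moreover have "end_sign D' i (c k + e k * r * x) = 0"
      by (rule tangle_end_sign_zero[OF D' lay(2) tan(2) _ x'(1)])
        (use k x' in \<open>auto simp: less_Suc_eq\<close>)
    ultimately show ?thesis using E by auto
  qed
  \<comment> \<open>The slope of strand 0 at its two crossings is m or -m; the signs of the ends
    depend on m > 0 only.\<close>
  define m where "m = 2 * a * (1 - a\<^sup>2)"
  have m: "0 < m" using a by (simp add: m_def power_less_one_iff)
  have der: "((?F ! 0) has_vector_derivative Complex 1 (- 2 * x * (1 - x\<^sup>2))) (at x)"
    "((?F ! 1) has_vector_derivative Complex 1 (1 / 2)) (at x)"
    "((?F ! 2) has_vector_derivative Complex 1 (- 1 / 2)) (at x)" 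
    "((?F' ! 0) has_vector_derivative Complex 1 (2 * x * (1 - x\<^sup>2))) (at x)" 
    "((?F' ! 1) has_vector_derivative Complex 1 (1 / 2)) (at x)"
    "((?F' ! 2) has_vector_derivative Complex 1 (- 1 / 2)) (at x)" for x
    by (auto intro!: has_vector_derivative_graph derivative_eq_intros bump_deriv)
  have der_a: "((?F ! 0) has_vector_derivative Complex 1 (- m)) (at a)"
    "((?F ! 0) has_vector_derivative Complex 1 m) (at (- a))"
    "((?F' ! 0) has_vector_derivative Complex 1 m) (at a)"
    "((?F' ! 0) has_vector_derivative Complex 1 (- m)) (at (- a))"
    using der(1)[of a] der(1)[of "- a"] der(4)[of a] der(4)[of "- a"] by (simp_all add: m_def)
  \<comment> \<open>Strand directions as integer signs, whose squares cancel at the end.\<close>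
  define o0 o1 o2 where "o0 = orient 0 (e 0)" and "o1 = orient 0 (e 1)" and "o2 = orient 0 (e 2)"
  note o_def = this
  have sq: "o0 * o0 = 1" "o1 * o1 = 1" "o2 * o2 = 1"
    using e by (auto simp: o_def orient_def)
  \<comment> \<open>The determinants of strand 0 with strand 1 and with strand 2 at their crossings;
    they are the same before and after the move.\<close>
  have sign: "orient 0 (1 / 2 + m) = 1" "orient 0 (- (1 / 2) - m) = - 1"
    using m by (auto simp: orient_def)
  have neg: "orient 0 (- x) = - orient 0 x" for x
    by (simp add: orient_def)
  have m01: "of_bool (mark E (c 0 + e 0 * r * x) = Virt i) = (of_bool (\<mu> = Virt i) :: int)"
    and m12: "of_bool (mark E (c 1 + e 1 * r * 0) = Virt i) = (of_bool (\<kappa> = Virt i) :: int)"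
    if "E \<in> {D, D'}" "x \<in> {-1..1}" for E x i
    using mk[OF that(1), of x] mk[OF that(1), of 0] that(2) by auto
  have s01: "end_sign D i (c 0 + e 0 * r * a) = of_bool (\<mu> = Virt i) * (o0 * o1)"
    "end_sign D i (c 1 + e 1 * r * a) = - of_bool (\<mu> = Virt i) * (o0 * o1)"
    "end_sign D' i (c 0 + e 0 * r * (- a)) = of_bool (\<mu> = Virt i) * (o0 * o1)"
    "end_sign D' i (c 1 + e 1 * r * (- a)) = - of_bool (\<mu> = Virt i) * (o0 * o1)" for i
    using tangle_end_sign[OF D lay(1) tan(1) _ _ _ _ _ _ der_a(1) der(2)[of a], of i]
      tangle_end_sign[OF D' lay(2) tan(2) _ _ _ _ _ _ der_a(4) der(5)[of "- a"], of i]
      a m01[of D a i] m01[of D' "- a" i]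
    by (simp_all add: cross2_def orient_zero_mult sign o_def)
  have s02: "end_sign D i (c 0 + e 0 * r * (- a)) = - of_bool (\<mu> = Virt i) * (o0 * o2)"
    "end_sign D i (c 2 + e 2 * r * (- a)) = of_bool (\<mu> = Virt i) * (o0 * o2)"
    "end_sign D' i (c 0 + e 0 * r * a) = - of_bool (\<mu> = Virt i) * (o0 * o2)"
    "end_sign D' i (c 2 + e 2 * r * a) = of_bool (\<mu> = Virt i) * (o0 * o2)" for i
    using tangle_end_sign[OF D lay(1) tan(1) _ _ _ _ _ _ der_a(2) der(3)[of "- a"], of i]
      tangle_end_sign[OF D' lay(2) tan(2) _ _ _ _ _ _ der_a(3) der(6)[of a], of i]
      a m01[of D "- a" i] m01[of D' a i]
    by (simp_all add: cross2_def orient_zero_mult sign o_def)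
  have s12: "end_sign E i (c 1 + e 1 * r * 0) = - of_bool (\<kappa> = Virt i) * (o1 * o2)"
    "end_sign E i (c 2 + e 2 * r * 0) = of_bool (\<kappa> = Virt i) * (o1 * o2)" if "E \<in> {D, D'}" for E i
    using tangle_end_sign[OF D lay(1) tan(1) _ _ _ _ _ _ der(2)[of 0] der(3)[of 0], of i]
      tangle_end_sign[OF D' lay(2) tan(2) _ _ _ _ _ _ der(5)[of 0] der(6)[of 0], of i]
      m12[of D 0 i] m12[of D' 0 i] that
    by (auto simp: cross2_def orient_zero_mult neg o_def)
  \<comment> \<open>In each diagram a line meets strand 0 on one side of the origin only, and at
    coordinate 0 strand 0 has height 1 / 2 or -1 / 2, away from both lines.\<close>
  have none: "end_sign D i (c 1 + e 1 * r * (- a)) = 0" "end_sign D' i (c 1 + e 1 * r * a) = 0"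
    "end_sign D i (c 2 + e 2 * r * a) = 0" "end_sign D' i (c 2 + e 2 * r * (- a)) = 0"
    "end_sign D i (c 0 + e 0 * r * 0) = 0" "end_sign D' i (c 0 + e 0 * r * 0) = 0" for i
  proof -
    have b: "bump 0 = 1" by (simp add: bump_def)
    show "end_sign D i (c 1 + e 1 * r * (- a)) = 0"
      by (rule tangle_end_sign_zero[OF D lay(1) tan(1)]) (use a in \<open>auto simp: less_Suc_eq\<close>)
    show "end_sign D i (c 2 + e 2 * r * a) = 0"
      by (rule tangle_end_sign_zero[OF D lay(1) tan(1)]) (use a in \<open>auto simp: less_Suc_eq\<close>)
    show "end_sign D i (c 0 + e 0 * r * 0) = 0"
      by (rule tangle_end_sign_zero[OF D lay(1) tan(1)]) (use b in \<open>auto simp: less_Suc_eq\<close>)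
    show "end_sign D' i (c 1 + e 1 * r * a) = 0"
      by (rule tangle_end_sign_zero[OF D' lay(2) tan(2)]) (use a in \<open>auto simp: less_Suc_eq\<close>)
    show "end_sign D' i (c 2 + e 2 * r * (- a)) = 0"
      by (rule tangle_end_sign_zero[OF D' lay(2) tan(2)]) (use a in \<open>auto simp: less_Suc_eq\<close>)
    show "end_sign D' i (c 0 + e 0 * r * 0) = 0"
      by (rule tangle_end_sign_zero[OF D' lay(2) tan(2)]) (use b in \<open>auto simp: less_Suc_eq\<close>)
  qed
  show ?thesis
  proof (rule intersection_number_local_move[OF D D' ij, of \<mu>])
    fix j assume j: "\<mu> \<noteq> Virt j"
    have \<nu>: "\<nu> \<noteq> Virt j" using virtual_crossing_marks[OF cm(1)] j by simp
    have zero0: "end_sign E j (c 0 + e 0 * r * x) = 0" if "E \<in> {D, D'}" "x \<in> {-1..1}" for E x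
      by (rule end_sign_zero_if_mark) (use mk[OF that] j in simp)
    have zero12: "end_sign E j (c 1 + e 1 * r * x) = 0" "end_sign E j (c 2 + e 2 * r * x) = 0"
      if "E \<in> {D, D'}" "x \<in> {-1..1} - {0}" for E x
      by (rule end_sign_zero_if_mark; use mk[OF that(1), of x] that \<nu> in simp)+
    show "end_sign D' j = end_sign D j"
    proof (rule end_sign_eqI[OF D D' move])
      fix k x assume k: "k < length ?F" and x: "x \<in> {-1..1::real}"
      show "end_sign D' j (c k + e k * r * x) = end_sign D j (c k + e k * r * x)"
        using strands[OF k] zero0[OF _ x] zero12[of _ x] s12[of _ j] x by (cases "x = 0") auto
    qed
    fix i assume "i \<noteq> j"
    let ?P = "primitive (end_sign D j)"
    let ?d = "\<lambda>k x. (end_sign D' i (c k + e k * r * x) - end_sign D i (c k + e k * r * x)) * ?P (c k + e k * r * x)"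
    note chain = circle_chain_end_sign[OF D, of j]
    \<comment> \<open>The coordinate 0 is included because the crossing of strands 1 and 2 may have
      type i; its end signs agree in both diagrams and drop out.\<close>
    have three: "(\<Sum>x\<in>{a, - a, 0}. h x) = h a + (h (- a) + h 0)" for h :: "real \<Rightarrow> int"
      using a by simp
    have P0: "?P (c 0 + e 0 * r * x) = ?P (c 0 - r)" if "x \<in> {-1..1}" for x
      by (rule primitive_strand_const[OF chain e(1) r _ that]) (use zero0 in auto)
    \<comment> \<open>The two end signs of strand 0 are exchanged between a and -a, where the
      primitive takes the same value.\<close>
    have sum0: "(\<Sum>x\<in>{a, - a, 0}. ?d 0 x) = 0"
      using P0[of a] P0[of "- a"] a s01[of i] s02[of i] none[of i]
      unfolding three by (simp add: algebra_simps)
    have P1: "?P (c 1 + e 1 * r * a) = ?P (c 1 + e 1 * r * (- a)) + o1 * end_sign D j (c 1)"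
      unfolding o_def by (rule primitive_strand_jump[OF chain e(2) r _ a(1,2)]) (use zero12 in auto)
    \<comment> \<open>The ends on strands 1 and 2 each pass one end of the chord of the crossing of these
      strands; the two contributions \<open>sum1\<close> and \<open>sum2\<close> are opposite because \<open>o1\<^sup>2 = o2\<^sup>2 = 1\<close>.\<close>
    have sum1: "(\<Sum>x\<in>{a, - a, 0}. ?d 1 x) =
        - of_bool (\<mu> = Virt i) * of_bool (\<kappa> = Virt j) * ((o1 * o1) * o0 * o1 * o2)"
      unfolding three s01 none P1
      using s12(1)[of D j] s12(1)[of D i] s12(1)[of D' i] by (simp add: algebra_simps)
    have P2: "?P (c 2 + e 2 * r * a) = ?P (c 2 + e 2 * r * (- a)) + o2 * end_sign D j (c 2)"
      unfolding o_def by (rule primitive_strand_jump[OF chain e(3) r _ a(1,2)]) (use zero12 in auto)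
    have sum2: "(\<Sum>x\<in>{a, - a, 0}. ?d 2 x) =
        of_bool (\<mu> = Virt i) * of_bool (\<kappa> = Virt j) * ((o2 * o2) * o0 * o1 * o2)"
      unfolding three s02 none P2
      using s12(2)[of D j] s12(2)[of D i] s12(2)[of D' i] by (simp add: algebra_simps)
    have "pairing (end_sign D' i) (end_sign D j) = pairing (end_sign D i) (end_sign D j) +
        (\<Sum>k<length ?F. \<Sum>x\<in>{a, - a, 0}. ?d k x)"
      by (rule pairing_local_move[OF D D' move]) (use a supp in auto)
    also have "(\<Sum>k<length ?F. \<Sum>x\<in>{a, - a, 0}. ?d k x) =
        (\<Sum>x\<in>{a, - a, 0}. ?d 0 x) + (\<Sum>x\<in>{a, - a, 0}. ?d 1 x) + (\<Sum>x\<in>{a, - a, 0}. ?d 2 x)"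
      by (simp add: numeral_eq_Suc del: sum.insert)
    also have "\<dots> = 0" unfolding sum0 sum1 sum2 sq by simp
    finally show "pairing (end_sign D' i) (end_sign D j) = pairing (end_sign D i) (end_sign D j)"
      by simp
  qed
qed

lemma intersection_number_step:
  assumes "mv_step T D D'" and ij: "i \<noteq> j"
  shows "intersection_number i j D' = intersection_number i j D"
proof -
  have D: "mv_diagram T D" and D': "mv_diagram T D'" using assms by (auto simp: mv_step_def)
  note slide = intersection_number_slide[OF D D' _ _ _ ij]
  consider "planar_isotopic D D'" | "omega1 D D'" | "omega2 D D'"
    | "omega3 D D'" | "omega3_v D D'" | "omega3_cv D D'"
    using assms by (auto simp: mv_step_def)
  then show ?thesis
  proof cases
    case 4
    then obtain \<kappa> \<kappa>' where "classical_marks \<kappa> \<kappa>'" "slide Over Under \<kappa> \<kappa>' D D'"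
      by (auto simp: omega3_def)
    \<comment> \<open>\<open>Over\<close> is no virtual mark, so in this case every chain of ends
      stays unchanged.\<close>
    then show ?thesis by (intro slide) (auto simp: crossing_marks_def classical_marks_def)
  next
    case 5
    then obtain k l where "slide (Virt k) (Virt k) (Virt l) (Virt l) D D'"
      by (auto simp: omega3_v_def)
    then show ?thesis by (intro slide) (auto simp: crossing_marks_def virtual_marks_def)
  next
    case 6
    then obtain k \<kappa> \<kappa>' where "classical_marks \<kappa> \<kappa>'" "slide (Virt k) (Virt k) \<kappa> \<kappa>' D D'"
      by (auto simp: omega3_cv_def)
    then show ?thesis by (intro slide) (auto simp: crossing_marks_def virtual_marks_def)
  qed (use D D' ij intersection_number_planar_isotopic intersection_number_omega1
      intersection_number_omega2 in blast)+
qed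

lemma intersection_number_equivalent:
  assumes "mv_equivalent T D D'" and "i \<noteq> j"
  shows "intersection_number i j D' = intersection_number i j D"
  using assms(1) unfolding mv_equivalent_def
proof (induction rule: equivclp_induct)
  case (step D1 D2)
  then show ?case
    using intersection_number_step[of T D1 D2, OF _ assms(2)]
      intersection_number_step[of T D2 D1, OF _ assms(2)] by auto
qed simp

section \<open>Compatibility of the map M with the moves\<close>

lemma M_diagram_simps [simp]:
  "curve (M_diagram D) = curve D"
  "velocity (M_diagram D) = velocity D"
  "double_param (M_diagram D) = double_param D"
  "crossing_points (M_diagram D) = crossing_points D"
  by (auto simp: M_diagram_def velocity_def double_param_def crossing_points_def fun_eq_iff)

text \<open>M leaves the curve alone, so its compatibility with the moves is a matter of this map of
  marks.\<close>

definition M_mark :: "mark \<Rightarrow> mark" where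
  "M_mark \<mu> = (case \<mu> of Virt i \<Rightarrow> Virt i | _ \<Rightarrow> Virt 0)"

lemma M_mark_simps [simp]: "M_mark Over = Virt 0" "M_mark Under = Virt 0" "M_mark (Virt i) = Virt i"
  by (simp_all add: M_mark_def)

lemma mark_M_diagram [simp]: "mark (M_diagram D) t = M_mark (mark D t)"
  by (simp add: M_diagram_def M_mark_def)

lemma crossing_marks_M: "crossing_marks \<mu> \<nu> \<Longrightarrow> crossing_marks (M_mark \<mu>) (M_mark \<nu>)"
  by (auto simp: crossing_marks_def classical_marks_def virtual_marks_def)

lemma classical_marks_M: "classical_marks \<kappa> \<kappa>' \<Longrightarrow> M_mark \<kappa> = Virt 0 \<and> M_mark \<kappa>' = Virt 0"
  by (auto simp: classical_marks_def)

lemma mv_diagram_M: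
  assumes "mv_diagram T D"
  shows "mv_diagram (insert 0 T) (M_diagram D)"
proof -
  have "(\<forall>i. mark D s = Virt i \<longrightarrow> i \<in> T) \<Longrightarrow> M_mark (mark D s) = Virt i \<Longrightarrow> i \<in> insert 0 T" for s i
    by (cases "mark D s") auto
  then show ?thesis
    using assms unfolding mv_diagram_def M_diagram_simps mark_M_diagram
    by (metis crossing_marks_M)
qed

lemma local_move_M:
  "local_move F F' c e r D D' \<Longrightarrow> local_move F F' c e r (M_diagram D) (M_diagram D')"
  unfolding local_move_def has_tangle_def by simp

lemma slide_M:
  assumes "slide \<mu> \<nu> \<kappa> \<kappa>' D D'"
  shows "slide (M_mark \<mu>) (M_mark \<nu>) (M_mark \<kappa>) (M_mark \<kappa>') (M_diagram D) (M_diagram D')"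
proof -
  let ?F = "[\<lambda>x. Complex x (bump x / 2), \<lambda>x. Complex x (x / 2), \<lambda>x. Complex x (- x / 2)]"
  let ?F' = "[\<lambda>x. Complex x (- bump x / 2), \<lambda>x. Complex x (x / 2), \<lambda>x. Complex x (- x / 2)]"
  obtain c e r where move: "local_move ?F ?F' c e r D D'"
    and mk: "\<And>E x. E \<in> {D, D'} \<Longrightarrow> x \<in> {-1..1} \<Longrightarrow>
           mark E (c 0 + e 0 * r * x) = \<mu> \<and>
           mark E (c 1 + e 1 * r * x) = (if x = 0 then \<kappa> else \<nu>) \<and>
           mark E (c 2 + e 2 * r * x) = (if x = 0 then \<kappa>' else \<nu>)"
    using assms unfolding slide_def by blast
  show ?thesis
    unfolding slide_def
    using local_move_M[OF move] mk by (intro exI[of _ c] exI[of _ e] exI[of _ r]) auto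
qed

text \<open>Planar isotopy and the first two moves keep their kind with the new marks. Every sliding
  move becomes \<open>omega3_v\<close>, in which the former classical crossings have type 0.\<close>

lemma mv_step_M:
  assumes "mv_step T D D'"
  shows "mv_step (insert 0 T) (M_diagram D) (M_diagram D')"
proof -
  have D: "mv_diagram T D" and D': "mv_diagram T D'" using assms by (auto simp: mv_step_def)
  consider "planar_isotopic D D'" | "omega1 D D'" | "omega2 D D'"
    | "omega3 D D'" | "omega3_v D D'" | "omega3_cv D D'"
    using assms by (auto simp: mv_step_def)
  then have "planar_isotopic (M_diagram D) (M_diagram D') \<or> omega1 (M_diagram D) (M_diagram D') \<or>
    omega2 (M_diagram D) (M_diagram D') \<or> omega3_v (M_diagram D) (M_diagram D')"
  proof cases
    case 1
    then have "planar_isotopic (M_diagram D) (M_diagram D')"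
      unfolding planar_isotopic_def M_diagram_simps mark_M_diagram by metis
    then show ?thesis by simp
  next
    case 2
    then obtain c e r \<mu> \<nu> where "local_move [\<lambda>x. Complex x 0] [kink] c e r D D'"
      "crossing_marks \<mu> \<nu>"
      "\<forall>x\<in>{-1..1}. mark D' (c 0 + e 0 * r * x) = (if x < 0 then \<mu> else \<nu>)"
      unfolding omega1_def by blast
    then have "omega1 (M_diagram D) (M_diagram D')"
      unfolding omega1_def
      by (intro exI[of _ c] exI[of _ e] exI[of _ r] exI[of _ "M_mark \<mu>"] exI[of _ "M_mark \<nu>"])
        (auto intro: local_move_M crossing_marks_M)
    then show ?thesis by simp
  next
    case 3
    then obtain c e r \<mu> \<nu> where "local_move
          [\<lambda>x. Complex x 0, \<lambda>x. Complex x (1 / 2)]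
          [\<lambda>x. Complex x 0, \<lambda>x. Complex x (1 / 2 - bump x)] c e r D D'"
      "crossing_marks \<mu> \<nu>"
      "\<forall>x\<in>{-1..1}. mark D' (c 0 + e 0 * r * x) = \<mu> \<and> mark D' (c 1 + e 1 * r * x) = \<nu>"
      unfolding omega2_def by blast
    then have "omega2 (M_diagram D) (M_diagram D')"
      unfolding omega2_def
      by (intro exI[of _ c] exI[of _ e] exI[of _ r] exI[of _ "M_mark \<mu>"] exI[of _ "M_mark \<nu>"])
        (auto intro: local_move_M crossing_marks_M)
    then show ?thesis by simp
  next
    case 4
    then obtain \<kappa> \<kappa>' where "classical_marks \<kappa> \<kappa>'" "slide Over Under \<kappa> \<kappa>' D D'"
      by (auto simp: omega3_def)
    then have "omega3_v (M_diagram D) (M_diagram D')"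
      using slide_M[of Over Under \<kappa> \<kappa>' D D'] classical_marks_M[of \<kappa> \<kappa>'] by (auto simp: omega3_v_def)
    then show ?thesis by simp
  next
    case 5
    then obtain k l where "slide (Virt k) (Virt k) (Virt l) (Virt l) D D'"
      by (auto simp: omega3_v_def)
    then have "omega3_v (M_diagram D) (M_diagram D')"
      using slide_M[of "Virt k" "Virt k" "Virt l" "Virt l" D D'] by (auto simp: omega3_v_def)
    then show ?thesis by simp
  next
    case 6
    then obtain k \<kappa> \<kappa>' where "classical_marks \<kappa> \<kappa>'" "slide (Virt k) (Virt k) \<kappa> \<kappa>' D D'"
      by (auto simp: omega3_cv_def)
    then have "omega3_v (M_diagram D) (M_diagram D')"
      using slide_M[of "Virt k" "Virt k" \<kappa> \<kappa>' D D'] classical_marks_M[of \<kappa> \<kappa>']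
      by (auto simp: omega3_v_def)
    then show ?thesis by simp
  qed
  then show ?thesis
    unfolding mv_step_def using mv_diagram_M[OF D] mv_diagram_M[OF D'] by blast
qed

lemma mv_equivalent_M:
  assumes "mv_equivalent T D D'"
  shows "mv_equivalent (insert 0 T) (M_diagram D) (M_diagram D')"
  using assms unfolding mv_equivalent_def
proof (induction rule: equivclp_induct)
  case (step D1 D2)
  then show ?case by (meson equivclp_into_equivclp mv_step_M)
qed simp

lemma mv_class_eq: "mv_equivalent T D D' \<Longrightarrow> mv_class T D = mv_class T D'"
  unfolding mv_class_def mv_equivalent_def by (blast intro: equivclp_trans equivclp_sym)

text \<open>Equivalent diagrams have equivalent images, so the union in \<open>M_knot\<close> is
  taken over copies of a single class.\<close>

lemma M_knot_mv_class:
  assumes "mv_diagram T D"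
  shows "M_knot T (mv_class T D) = mv_class (insert 0 T) (M_diagram D)"
proof -
  have "mv_class (insert 0 T) (M_diagram D') = mv_class (insert 0 T) (M_diagram D)"
    if "D' \<in> mv_class T D" for D'
    using that mv_class_eq[OF mv_equivalent_M] by (auto simp: mv_class_def[of T])
  moreover have "D \<in> mv_class T D" using assms by (simp add: mv_class_def mv_equivalent_def)
  ultimately show ?thesis unfolding M_knot_def by blast
qed

lemma intersection_number_no_crossings:
  assumes "crossing_points D = {}"
  shows "intersection_number i j D = 0"
proof -
  have "virtual_chords D i = {}"
  proof (rule ccontr)
    assume "virtual_chords D i \<noteq> {}"
    then obtain s t where "(s, t) \<in> virtual_chords D i" by auto
    then have "tail_at D i s" by (rule virtual_chord_tail_head)
    then have "double_param D s" by (auto simp: tail_at_def double_param_def)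
    then show False using assms by (auto simp: crossing_points_def)
  qed
  then show ?thesis by (simp add: intersection_number_def)
qed

section \<open>The trefoil diagram\<close>

lemma cos_add_2pi_int: "cos (x + 2 * pi * of_int n) = cos x" "sin (x + 2 * pi * of_int n) = sin x"
  using sin_cos_eq_iff[of "x + 2 * pi * of_int n" x] by blast+

lemma trefoil_curve_add_1: "trefoil_curve (t + 1) = trefoil_curve t"
proof -
  have "6 * pi * (t + 1) = 6 * pi * t + 2 * pi * of_int 3" "4 * pi * (t + 1) = 4 * pi * t + 2 * pi * of_int 2"
    by (simp_all add: algebra_simps)
  then show ?thesis
    unfolding trefoil_curve_def cis.ctr by (simp only: cos_add_2pi_int)
qed

text \<open>At odd multiples of 1 / 12 the cosine vanishes and the radius is 2, also after a shift
  by half a period; this shift changes the angle by a multiple of 2 pi.\<close>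

lemma trefoil_curve_partner:
  assumes "odd n"
  shows "trefoil_curve (of_int n / 12 + (1 / 2 + of_int m)) = trefoil_curve (of_int n / 12)"
proof -
  have cos0: "cos (6 * pi * (of_int n / 12)) = 0"
    unfolding cos_zero_iff_int using assms by (intro exI[of _ n]) simp
  have "6 * pi * (of_int n / 12 + (1 / 2 + of_int m)) = (of_int (n + 6 + 12 * m)) * (pi / 2)"
    by (simp add: field_simps)
  moreover have "odd (n + 6 + 12 * m)" using assms by simp
  ultimately have cos1: "cos (6 * pi * (of_int n / 12 + (1 / 2 + of_int m))) = 0"
    unfolding cos_zero_iff_int by blast
  have "4 * pi * (of_int n / 12 + (1 / 2 + of_int m)) = 4 * pi * (of_int n / 12) + 2 * pi * of_int (1 + 2 * m)"
    by (simp add: field_simps)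
  then show ?thesis
    unfolding trefoil_curve_def cos0 cos1 cis.ctr by (simp only: cos_add_2pi_int)
qed

text \<open>Equal arguments give s - t = k / 2, with k odd since s - t is not an integer. Such a
  shift reverses the sign of cos (6 pi t), so equal radii force this cosine to vanish.\<close>

lemma trefoil_curve_eqE:
  assumes "s - t \<notin> \<int>" "trefoil_curve s = trefoil_curve t"
  obtains n m :: int where "odd n" "t = of_int n / 12" "s = of_int n / 12 + (1 / 2 + of_int m)"
proof -
  define p q where "p = 2 + cos (6 * pi * s)" and "q = 2 + cos (6 * pi * t)"
  have pos: "0 < p" "0 < q"
    using cos_ge_minus_one[of "6 * pi * s"] cos_ge_minus_one[of "6 * pi * t"]
    unfolding p_def q_def by linarith+
  have eq: "of_real p * cis (4 * pi * s) = of_real q * cis (4 * pi * t)"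
    using assms(2) by (simp add: trefoil_curve_def p_def q_def)
  then have "cmod (of_real p * cis (4 * pi * s)) = cmod (of_real q * cis (4 * pi * t))" by simp
  then have pq: "p = q" using pos by (simp add: norm_mult)
  then have "cis (4 * pi * s) = cis (4 * pi * t)" using eq pos by simp
  then have "sin (4 * pi * s) = sin (4 * pi * t) \<and> cos (4 * pi * s) = cos (4 * pi * t)"
    by (simp add: complex_eq_iff)
  then obtain k :: int where k: "4 * pi * s = 4 * pi * t + 2 * pi * of_int k"
    unfolding sin_cos_eq_iff by blast
  then have "2 * pi * (2 * s) = 2 * pi * (2 * t + of_int k)" by (simp add: algebra_simps)
  then have k': "2 * s = 2 * t + of_int k" using pi_gt_zero by (metis mult_cancel_left mult_eq_0_iff pi_neq_zero zero_neq_numeral)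
  have "odd k"
  proof
    assume "even k"
    then obtain m where "k = 2 * m" by (auto elim: evenE)
    then have "s - t = of_int m" using k' by simp
    then show False using assms(1) by simp
  qed
  then obtain m where m: "k = 2 * m + 1" by (auto elim: oddE)
  then have s: "s = t + (1 / 2 + of_int m)" using k' by simp
  have "6 * pi * s = (6 * pi * t + pi) + 2 * pi * of_int (3 * m + 1)"
    unfolding s by (simp add: algebra_simps)
  then have "cos (6 * pi * s) = - cos (6 * pi * t)"
    by (simp only: cos_add_2pi_int cos_periodic_pi)
  then have "cos (6 * pi * t) = 0" using pq by (simp add: p_def q_def)
  then obtain n where n: "odd n" "6 * pi * t = of_int n * (pi / 2)"
    unfolding cos_zero_iff_int by blast
  then have "pi * (12 * t) = pi * of_int n" by (simp add: field_simps)
  then have "12 * t = of_int n" using pi_neq_zero by (metis mult_cancel_left)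
  then show thesis using that[of n m] n(1) s by simp
qed

text \<open>In the moving frame \<open>cis (4 * pi * t)\<close> the velocity has the radial component
  \<open>- 6 * pi * sin (6 * pi * t)\<close> and the angular component \<open>4 * pi * (2 + cos (6 * pi * t))\<close>.\<close>

definition trefoil_velocity :: "real \<Rightarrow> complex" where
  "trefoil_velocity t =
     Complex (- 6 * pi * sin (6 * pi * t)) (4 * pi * (2 + cos (6 * pi * t))) * cis (4 * pi * t)"

lemma trefoil_curve_has_velocity:
  "(trefoil_curve has_vector_derivative trefoil_velocity t) (at t)"
proof -
  have r: "((\<lambda>t. 2 + cos (6 * pi * t)) has_real_derivative (- 6 * pi * sin (6 * pi * t))) (at t)"
    by (auto intro!: derivative_eq_intros)
  have "((\<lambda>t. cis (4 * pi * t)) has_vector_derivative (4 * pi) *\<^sub>R (\<i> * cis (4 * pi * t))) (at t)"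
    unfolding has_vector_derivative_def
    by (auto intro!: derivative_eq_intros simp: scaleR_conv_of_real)
  then have "((\<lambda>t. of_real (2 + cos (6 * pi * t)) * cis (4 * pi * t)) has_vector_derivative
      of_real (2 + cos (6 * pi * t)) * ((4 * pi) *\<^sub>R (\<i> * cis (4 * pi * t))) +
      of_real (- 6 * pi * sin (6 * pi * t)) * cis (4 * pi * t)) (at t)"
    by (intro has_vector_derivative_mult has_vector_derivative_of_real r)
  moreover have "of_real (2 + cos (6 * pi * t)) * ((4 * pi) *\<^sub>R (\<i> * cis (4 * pi * t))) +
      of_real (- 6 * pi * sin (6 * pi * t)) * cis (4 * pi * t) = trefoil_velocity t"
    unfolding trefoil_velocity_def by (simp add: complex_eq_iff algebra_simps)
  ultimately show ?thesis unfolding trefoil_curve_def[abs_def] by simp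
qed

lemma velocity_K1 [simp]: "velocity K1_diagram = trefoil_velocity"
  using vector_derivative_at[OF trefoil_curve_has_velocity]
  by (auto simp: velocity_def K1_diagram_def)

lemma curve_K1 [simp]: "curve K1_diagram = trefoil_curve"
  by (simp add: K1_diagram_def)

lemma cross2_mult_right: "cross2 (v * u) (w * u) = cross2 v w * ((Re u)\<^sup>2 + (Im u)\<^sup>2)"
  by (simp add: cross2_def algebra_simps power2_eq_square)

text \<open>Partners share the moving frame. Their angular components are both 8 pi and their radial
  components are opposite, of absolute value 6 pi; hence the constant 96 = 2 * 6 * 8.\<close>

lemma cross2_trefoil_velocity:
  assumes "odd n"
  shows "cross2 (trefoil_velocity (of_int n / 12)) (trefoil_velocity (of_int n / 12 + (1 / 2 + of_int m))) =
    - 96 * pi\<^sup>2 * sin (of_int n * pi / 2)"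
proof -
  let ?t = "of_int n / 12 :: real" and ?s = "of_int n / 12 + (1 / 2 + of_int m) :: real"
  have t6: "6 * pi * ?t = of_int n * pi / 2" by simp
  have cos0: "cos (of_int n * pi / 2) = 0"
    unfolding cos_zero_iff_int using assms by (intro exI[of _ n]) simp
  have s6: "6 * pi * ?s = (of_int n * pi / 2 + pi) + 2 * pi * of_int (3 * m + 1)"
    and s4: "4 * pi * ?s = 4 * pi * ?t + 2 * pi * of_int (1 + 2 * m)"
    by (simp_all add: field_simps)
  have s: "cos (6 * pi * ?s) = 0" "sin (6 * pi * ?s) = - sin (of_int n * pi / 2)"
    unfolding s6 cos_add_2pi_int using cos0 by simp_all
  have cis: "cis (4 * pi * ?s) = cis (4 * pi * ?t)"
    unfolding s4 cis.ctr cos_add_2pi_int ..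
  have rotate: "cross2 (v * cis x) (w * cis x) = cross2 v w" for v w x
    using cross2_mult_right[of v "cis x" w] by simp
  show ?thesis
    unfolding trefoil_velocity_def s cis rotate t6 cos0
    by (simp add: cross2_def power2_eq_square)
qed

lemma sin_odd_half_pi:
  "n mod 4 = 1 \<Longrightarrow> sin (of_int n * pi / 2) = 1" "n mod 4 = 3 \<Longrightarrow> sin (of_int n * pi / 2) = - 1"
proof -
  assume "n mod 4 = 1"
  then have "n = 1 + 4 * (n div 4)" by presburger
  then have "real_of_int n = 1 + 4 * of_int (n div 4)"
    by (metis of_int_1 of_int_add of_int_mult of_int_numeral)
  then have "of_int n * pi / 2 = pi / 2 + 2 * pi * of_int (n div 4)"
    by (simp add: field_simps)
  then show "sin (of_int n * pi / 2) = 1" by (simp only: cos_add_2pi_int sin_pi_half)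
next
  assume "n mod 4 = 3"
  then have "n = 3 + 4 * (n div 4)" by presburger
  then have "real_of_int n = 3 + 4 * of_int (n div 4)"
    by (metis of_int_add of_int_mult of_int_numeral)
  then have "of_int n * pi / 2 = (pi / 2 + pi) + 2 * pi * of_int (n div 4)"
    by (simp add: field_simps)
  then show "sin (of_int n * pi / 2) = - 1" by (simp only: cos_add_2pi_int sin_periodic_pi sin_pi_half)
qed

section \<open>Parameters that are multiples of 1/12\<close>

lemma frac_twelfth: "frac (of_int n / 12 :: real) = of_int (n mod 12) / 12"
proof -
  have "of_int n / 12 - of_int (n mod 12) / 12 = (of_int (n div 12) :: real)"
  proof -
    have "n = n mod 12 + 12 * (n div 12)" by presburger
    then have "real_of_int n = of_int (n mod 12) + 12 * of_int (n div 12)"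
      by (metis of_int_add of_int_mult of_int_numeral)
    then show ?thesis by (simp add: field_simps)
  qed
  moreover have "0 \<le> n mod 12" "n mod 12 < 12" by simp_all
  ultimately show ?thesis unfolding frac_unique_iff by simp
qed

lemma twelfths_partner: "of_int n / 12 + (1 / 2 + of_int m) = (of_int (n + 6 + 12 * m) / 12 :: real)"
  by (simp add: field_simps)

lemma mark_K1_twelfth:
  "mark K1_diagram (of_int n / 12) = (if n mod 12 = 7 then Over else if n mod 12 = 1 then Under
     else if n mod 12 = 3 \<or> n mod 12 = 9 then Virt 1 else Virt 2)"
  unfolding K1_diagram_def diagram.select_convs frac_twelfth by simp

lemma mv_diagram_K1: "mv_diagram {1, 2} K1_diagram"
proof -
  have odd_cases: "n mod 12 \<in> {1, 3, 5, 7, 9, 11}" if "odd n" for n :: int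
    using that by (simp; presburger)
  have dbl: "cross2 (trefoil_velocity s) (trefoil_velocity t) \<noteq> 0 \<and>
        crossing_marks (mark K1_diagram s) (mark K1_diagram t) \<and>
        (\<forall>i. mark K1_diagram s = Virt i \<longrightarrow> i \<in> {1, 2})"
    if st: "s - t \<notin> \<int>" "trefoil_curve s = trefoil_curve t" for s t
  proof -
    obtain n m where n: "odd n" "t = of_int n / 12" and s: "s = of_int n / 12 + (1 / 2 + of_int m)"
      using trefoil_curve_eqE[OF st] by metis
    have "n mod 4 = 1 \<or> n mod 4 = 3" using n(1) by presburger
    then have "cross2 (trefoil_velocity t) (trefoil_velocity s) \<noteq> 0"
      unfolding n(2) s cross2_trefoil_velocity[OF n(1)] using sin_odd_half_pi[of n] by auto
    then have "cross2 (trefoil_velocity s) (trefoil_velocity t) \<noteq> 0"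
      using cross2_swap[of "trefoil_velocity s" "trefoil_velocity t"] by simp
    \<comment> \<open>Partners differ by 6 modulo 12, which leaves six residues to check.\<close>
    moreover have "(n + 6 + 12 * m) mod 12 = (n mod 12 + 6) mod 12" by presburger
    then have "crossing_marks (mark K1_diagram s) (mark K1_diagram t)"
      unfolding n(2) s twelfths_partner mark_K1_twelfth using odd_cases[OF n(1)]
      by (auto simp: crossing_marks_def classical_marks_def virtual_marks_def)
    moreover have "mark K1_diagram s = Virt i \<Longrightarrow> i \<in> {1, 2}" for i
      by (auto simp: K1_diagram_def split: if_splits)
    ultimately show ?thesis by blast
  qed
  have "crossing_points K1_diagram \<subseteq> trefoil_curve ` (\<lambda>n. of_int n / 12) ` {0..<12 :: int}"
  proof
    fix z assume "z \<in> crossing_points K1_diagram"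
    then obtain s t where "s - t \<notin> \<int>" "trefoil_curve s = trefoil_curve t" and z: "z = trefoil_curve t"
      by (auto simp: crossing_points_def double_param_def)
    then obtain n m where n: "odd n" "t = of_int n / 12" using trefoil_curve_eqE by metis
    have "trefoil_curve (x + of_int k) = trefoil_curve x" for x k
    proof (induction k rule: int_induct[where k = 0])
      case (step1 i)
      then show ?case using trefoil_curve_add_1[of "x + of_int i"] by (simp add: algebra_simps)
    next
      case (step2 i)
      then show ?case using trefoil_curve_add_1[of "x + of_int (i - 1)"] by (simp add: algebra_simps)
    qed simp
    from this[of "frac t" "\<lfloor>t\<rfloor>"] have "z = trefoil_curve (of_int (n mod 12) / 12)"
      unfolding z by (simp add: frac_twelfth[symmetric] n(2)[symmetric]) (simp add: frac_def)
    then show "z \<in> trefoil_curve ` (\<lambda>n. of_int n / 12) ` {0..<12 :: int}" by auto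
  qed
  then have fin: "finite (crossing_points K1_diagram)" by (rule finite_subset) simp
  have "continuous_on UNIV trefoil_velocity"
    unfolding trefoil_velocity_def[abs_def] Complex_eq cis_conv_exp by (intro continuous_intros)
  then have C1: "trefoil_curve C1_differentiable_on UNIV"
    unfolding C1_differentiable_on_def using trefoil_curve_has_velocity by blast
  have nz: "trefoil_velocity t \<noteq> 0" for t
  proof -
    have "0 < 2 + cos (6 * pi * t)" using cos_ge_minus_one[of "6 * pi * t"] by linarith
    then show ?thesis unfolding trefoil_velocity_def by (simp add: Complex_eq_0)
  qed
  have triple: "\<not> (trefoil_curve s = trefoil_curve t \<and> trefoil_curve t = trefoil_curve u)"
    if stu: "s - t \<notin> \<int>" "t - u \<notin> \<int>" "s - u \<notin> \<int>" for s t u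
  proof
    assume eq: "trefoil_curve s = trefoil_curve t \<and> trefoil_curve t = trefoil_curve u"
    obtain n m where 1: "t = of_int n / 12" "s = of_int n / 12 + (1 / 2 + of_int m)"
      using trefoil_curve_eqE[OF stu(1)] eq by metis
    obtain n' m' where 2: "u = of_int n' / 12" "t = of_int n' / 12 + (1 / 2 + of_int m')"
      using trefoil_curve_eqE[OF stu(2)] eq by metis
    \<comment> \<open>Two shifts by half a period make up a whole number of periods.\<close>
    have "s - u = of_int (1 + m + m')" using 1 2 by simp
    then show False using stu(3) by (metis Ints_of_int)
  qed
  have per: "mark K1_diagram (t + 1) = mark K1_diagram t" for t
    by (simp add: K1_diagram_def frac_1_eq)
  show ?thesis
    unfolding mv_diagram_def curve_K1 velocity_K1
    using trefoil_curve_add_1 per C1 nz fin dbl triple by blast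
qed

text \<open>M gives both preimages of the classical crossing the type 0. The type then depends on n
  modulo 6 only, the residues 1, 3, 5 giving 0, 1, 2.\<close>

lemma mark_MK1_twelfth:
  assumes "odd n"
  shows "mark (M_diagram K1_diagram) (of_int n / 12) = Virt (nat (n mod 6 div 2))"
proof -
  define k where "k = n mod 12"
  have "k \<in> {1, 3, 5, 7, 9, 11}" unfolding k_def using assms by (simp; presburger)
  moreover have "n mod 6 = k mod 6" unfolding k_def by (simp add: mod_mod_cancel)
  ultimately show ?thesis
    unfolding mark_M_diagram mark_K1_twelfth k_def[symmetric] by auto
qed

text \<open>If n is 1 modulo 4, the curve moves inwards at this parameter and outwards at its
  partner, so the end is a head; if n is 3 modulo 4, it is a tail.\<close>

lemma end_sign_MK1:
  assumes "odd n"
  shows "end_sign (M_diagram K1_diagram) i (of_int n / 12) =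
    (if i = nat (n mod 6 div 2) then if n mod 4 = 1 then - 1 else 1 else 0)"
proof -
  have D: "mv_diagram {0, 1, 2} (M_diagram K1_diagram)"
    using mv_diagram_M[OF mv_diagram_K1] by simp
  let ?s = "of_int n / 12 + (1 / 2 + of_int 0) :: real"
  have "?s - of_int n / 12 \<notin> \<int>"
    by (auto elim!: Ints_cases)
  then have "end_sign (M_diagram K1_diagram) i (of_int n / 12) =
      of_bool (Virt (nat (n mod 6 div 2)) = Virt i) * orient 0 (- 96 * pi\<^sup>2 * sin (of_int n * pi / 2))"
    using end_sign_partner[OF D, of ?s "of_int n / 12" i] trefoil_curve_partner[OF assms, of 0]
      cross2_trefoil_velocity[OF assms, of 0] mark_MK1_twelfth[OF assms] by simp
  moreover have "n mod 4 = 1 \<or> n mod 4 = 3" using assms by presburger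
  moreover have "orient 0 (- 96 * pi\<^sup>2) = - 1" "orient 0 (96 * pi\<^sup>2) = 1" by (auto simp: orient_def)
  ultimately show ?thesis using sin_odd_half_pi[of n] by auto
qed

lemma end_sign_MK1_support:
  "{t. t \<in> {0..<1} \<and> end_sign (M_diagram K1_diagram) i t \<noteq> 0} =
     (\<lambda>n. of_int n / 12) ` {n \<in> {1, 3, 5, 7, 9, 11}. i = nat (n mod 6 div 2)}"
proof (intro equalityI subsetI)
  fix t assume t: "t \<in> {t. t \<in> {0..<1} \<and> end_sign (M_diagram K1_diagram) i t \<noteq> 0}"
  then have "double_param K1_diagram t" using double_param_if_end_sign[of "M_diagram K1_diagram" i t] by simp
  then obtain s where "s - t \<notin> \<int>" "trefoil_curve s = trefoil_curve t" by (auto simp: double_param_def)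
  then obtain n where n: "odd n" "t = of_int n / 12" using trefoil_curve_eqE by metis
  then have "0 \<le> n" "n < 12" using t by auto
  then have "n \<in> {1, 3, 5, 7, 9, 11}" using n(1) by (simp; presburger)
  moreover have "i = nat (n mod 6 div 2)" using t end_sign_MK1[OF n(1), of i] unfolding n(2) by (auto split: if_splits)
  ultimately show "t \<in> (\<lambda>n. of_int n / 12) ` {n \<in> {1, 3, 5, 7, 9, 11}. i = nat (n mod 6 div 2)}"
    using n(2) by blast
next
  fix t :: real assume "t \<in> (\<lambda>n. of_int n / 12) ` {n \<in> {1, 3, 5, 7, 9, 11}. i = nat (n mod 6 div 2)}"
  then obtain n where n: "n \<in> {1, 3, 5, 7, 9, 11}" "i = nat (n mod 6 div 2)" "t = of_int n / 12" by blast
  then have "odd n" by auto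
  show "t \<in> {t. t \<in> {0..<1} \<and> end_sign (M_diagram K1_diagram) i t \<noteq> 0}"
  proof -
    have "end_sign (M_diagram K1_diagram) i t \<noteq> 0"
      unfolding n(3) using end_sign_MK1[OF \<open>odd n\<close>, of i] n(2) by simp
    moreover have "t \<in> {0..<1}" using n(1,3) by auto
    ultimately show ?thesis by simp
  qed
qed

text \<open>In the order of their parameters the six ends have the types 0, 1, 2, 0, 1, 2 and
  alternating signs, beginning with -1.\<close>

lemma intersection_number_MK1:
  "intersection_number 0 1 (M_diagram K1_diagram) = -1"
  "intersection_number 1 2 (M_diagram K1_diagram) = -1"
  "intersection_number 0 2 (M_diagram K1_diagram) = 1"
proof -
  let ?D = "M_diagram K1_diagram"
  have D: "mv_diagram {0, 1, 2} ?D"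
    using mv_diagram_M[OF mv_diagram_K1] by simp
  have pick: "{n \<in> {1, 3, 5, 7, 9, 11 :: int}. 0 = nat (n mod 6 div 2)} = {1, 7}"
    "{n \<in> {1, 3, 5, 7, 9, 11 :: int}. 1 = nat (n mod 6 div 2)} = {3, 9}"
    "{n \<in> {1, 3, 5, 7, 9, 11 :: int}. 2 = nat (n mod 6 div 2)} = {5, 11}"
    by auto
  have supp: "{t. t \<in> {0..<1} \<and> end_sign ?D 0 t \<noteq> 0} = {1 / 12, 7 / 12}"
    "{t. t \<in> {0..<1} \<and> end_sign ?D 1 t \<noteq> 0} = {3 / 12, 9 / 12}"
    "{t. t \<in> {0..<1} \<and> end_sign ?D 2 t \<noteq> 0} = {5 / 12, 11 / 12}"
    unfolding end_sign_MK1_support pick by simp_all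
  have val: "end_sign ?D 0 (1 / 12) = -1" "end_sign ?D 0 (7 / 12) = 1"
    "end_sign ?D 1 (3 / 12) = 1" "end_sign ?D 1 (9 / 12) = -1"
    "end_sign ?D 2 (5 / 12) = -1" "end_sign ?D 2 (11 / 12) = 1"
    using end_sign_MK1[of 1 0] end_sign_MK1[of 7 0] end_sign_MK1[of 3 1] end_sign_MK1[of 9 1]
      end_sign_MK1[of 5 2] end_sign_MK1[of 11 2] by simp_all
  have eq: "intersection_number i j ?D = (\<Sum>s | s \<in> {0..<1} \<and> end_sign ?D j s \<noteq> 0.
      \<Sum>t | t \<in> {0..<1} \<and> end_sign ?D i t \<noteq> 0. end_sign ?D j s * end_sign ?D i t * of_bool (t < s))"
    if "i \<noteq> j" for i j
    unfolding intersection_number_eq_pairing[OF D that]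
    by (rule pairing_eq_double_sum) (rule circle_chain_end_sign[OF D])+
  have two: "sum h {x, y} = h x + h y" if "x \<noteq> y" for h :: "real \<Rightarrow> int" and x y
    using that by simp
  show "intersection_number 0 1 ?D = -1"
    by (subst eq) (simp, unfold supp, subst two, simp, subst (1 2) two, simp, simp add: val[simplified])
  show "intersection_number 1 2 ?D = -1"
    by (subst eq) (simp, unfold supp, subst two, simp, subst (1 2) two, simp, simp add: val[simplified])
  show "intersection_number 0 2 ?D = 1"
    by (subst eq) (simp, unfold supp, subst two, simp, subst (1 2) two, simp, simp add: val[simplified])
qed

section \<open>The three crossings of the trefoil diagram and their types\<close>

lemma crossing_points_MK1:
  "\<exists>p. inj_on p {0, 1, 2 :: nat} \<and> crossing_points (M_diagram K1_diagram) = p ` {0, 1, 2} \<and>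
     (\<forall>i \<in> {0, 1, 2}. \<forall>t. curve (M_diagram K1_diagram) t = p i \<longrightarrow> mark (M_diagram K1_diagram) t = Virt i)"
proof -
  let ?D = "M_diagram K1_diagram"
  \<comment> \<open>The crossing of type i is represented by the smaller of its two parameters in
    [0, 1).\<close>
  define p where "p i = trefoil_curve (of_int (2 * int i + 1) / 12)" for i
  have D: "mv_diagram {0, 1, 2} ?D"
    using mv_diagram_M[OF mv_diagram_K1] by simp
  have mark_p: "mark ?D t = Virt i" if i: "i \<in> {0, 1, 2}" and t: "trefoil_curve t = p i" for i t
  proof -
    let ?n = "2 * int i + 1"
    have n: "odd ?n" by simp
    have mk: "mark ?D (of_int ?n / 12) = Virt i"
      using mark_MK1_twelfth[OF n] i by auto
    show ?thesis
    proof (cases "t - of_int ?n / 12 \<in> \<int>")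
      case True
      then show ?thesis using mark_cong[OF D True] mk by simp
    next
      case False
      then show ?thesis
        using virtual_mark_partner[OF D False, of i] t mk by (simp add: p_def)
    qed
  qed
  have "inj_on p {0, 1, 2}"
  proof (rule inj_onI)
    fix i j :: nat assume "i \<in> {0, 1, 2}" "j \<in> {0, 1, 2}" "p i = p j"
    \<comment> \<open>Both preimages of a crossing have the same virtual type, so the types separate
      the three points.\<close>
    then have "Virt i = Virt j"
      using mark_p[of i "of_int (2 * int i + 1) / 12"] mark_p[of j "of_int (2 * int i + 1) / 12"]
      by (simp add: p_def del: mark_M_diagram)
    then show "i = j" by simp
  qed
  moreover have "crossing_points ?D = p ` {0, 1, 2}"
  proof (intro equalityI subsetI)
    fix z assume "z \<in> crossing_points ?D"
    then obtain s t where st: "s - t \<notin> \<int>" "trefoil_curve s = trefoil_curve t" and z: "z = trefoil_curve t"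
      by (auto simp: crossing_points_def double_param_def)
    then obtain n where n: "odd n" "t = of_int n / 12" using trefoil_curve_eqE by metis
    define i where "i = nat (n mod 6 div 2)"
    define k where "k = n div 6"
    have i: "i \<in> {0, 1, 2}" unfolding i_def by (auto; presburger)
    have "n mod 6 = 2 * int i + 1" using n(1) unfolding i_def by simp presburger
    then have nk: "n = 2 * int i + 1 + 6 * k" unfolding k_def by presburger
    \<comment> \<open>For even k the parameter t agrees with the chosen one modulo 1; for odd k it
      is the partner of the chosen one.\<close>
    have "trefoil_curve t = p i"
    proof (cases "even k")
      case True
      then obtain m where "k = 2 * m" by (auto elim: evenE)
      then have "t - of_int (2 * int i + 1) / 12 = of_int m" unfolding n(2) nk by (simp add: field_simps)
      then have "t - of_int (2 * int i + 1) / 12 \<in> \<int>" by simp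
      then show ?thesis using curve_cong[OF D] by (simp add: p_def)
    next
      case False
      then obtain m where "k = 2 * m + 1" by (auto elim: oddE)
      then have "t = of_int (2 * int i + 1) / 12 + (1 / 2 + of_int m)" unfolding n(2) nk by (simp add: field_simps)
      then show ?thesis using trefoil_curve_partner[of "2 * int i + 1" m] by (simp add: p_def)
    qed
    then show "z \<in> p ` {0, 1, 2}" using i z by blast
  next
    fix z assume "z \<in> p ` {0, 1, 2}"
    then obtain i where z: "z = p i" by blast
    let ?t = "of_int (2 * int i + 1) / 12 :: real"
    have "trefoil_curve (?t + (1 / 2 + of_int 0)) = trefoil_curve ?t"
      by (rule trefoil_curve_partner) simp
    moreover have "?t + (1 / 2 + of_int 0) - ?t \<notin> \<int>"
      by (auto elim!: Ints_cases)
    ultimately have "double_param ?D ?t" unfolding double_param_def M_diagram_simps curve_K1 by blast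
    then show "z \<in> crossing_points ?D" unfolding z p_def crossing_points_def by simp
  qed
  ultimately show ?thesis using mark_p by (intro exI[of _ p]) simp
qed

theorem mainTheorem3:
  shows "K1 \<in> mv_knots {1, 2} \<and>
    M_knot {1, 2} K1 \<in> mv_knots {0, 1, 2} \<and>
    (\<exists>D \<in> M_knot {1, 2} K1. D = M_diagram K1_diagram \<and> curve D = trefoil_curve \<and>
      (\<exists>p. inj_on p {0, 1, 2 :: nat} \<and> crossing_points D = p ` {0, 1, 2} \<and>
        (\<forall>i \<in> {0, 1, 2}. \<forall>t. curve D t = p i \<longrightarrow> mark D t = Virt i))) \<and>
    (\<forall>D \<in> M_knot {1, 2} K1.
      intersection_number 0 1 D = -1 \<and>
      intersection_number 1 2 D = -1 \<and>
      intersection_number 0 2 D = 1) \<and>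
    \<not> trivial_knot (M_knot {1, 2} K1) \<and>
    \<not> (\<forall>T. finite T \<and> 0 \<notin> T \<longrightarrow>
        (\<forall>K \<in> mv_knots T. trivial_knot (M_knot T K)))"
proof -
  let ?D = "M_diagram K1_diagram"
  have D: "mv_diagram {0, 1, 2} ?D"
    using mv_diagram_M[OF mv_diagram_K1] by simp
  have K1: "K1 \<in> mv_knots {1, 2}"
    unfolding K1_def mv_knots_def using mv_diagram_K1 by blast
  have M: "M_knot {1, 2} K1 = mv_class {0, 1, 2} ?D"
    unfolding K1_def by (rule M_knot_mv_class[OF mv_diagram_K1])
  have MK1: "M_knot {1, 2} K1 \<in> mv_knots {0, 1, 2}"
    unfolding M mv_knots_def using D by blast
  have mem: "?D \<in> M_knot {1, 2} K1"
    unfolding M using D by (simp add: mv_class_def mv_equivalent_def)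
  have inv: "intersection_number 0 1 D = -1 \<and> intersection_number 1 2 D = -1 \<and>
      intersection_number 0 2 D = 1" if "D \<in> M_knot {1, 2} K1" for D
  proof -
    have "mv_equivalent {0, 1, 2} ?D D" using that unfolding M by (simp add: mv_class_def)
    then show ?thesis
      using intersection_number_MK1 intersection_number_equivalent[of "{0, 1, 2}" ?D D] by simp
  qed
  have nontrivial: "\<not> trivial_knot (M_knot {1, 2} K1)"
  proof
    assume "trivial_knot (M_knot {1, 2} K1)"
    then obtain D where "D \<in> M_knot {1, 2} K1" "crossing_points D = {}"
      by (auto simp: trivial_knot_def)
    \<comment> \<open>All intersection numbers of a diagram without crossings are 0, in contrast to
      the value 1 for the types 0 and 2.\<close>
    then show False using inv[of D] intersection_number_no_crossings[of D 0 2] by simp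
  qed
  have "\<exists>D \<in> M_knot {1, 2} K1. D = M_diagram K1_diagram \<and> curve D = trefoil_curve \<and>
      (\<exists>p. inj_on p {0, 1, 2 :: nat} \<and> crossing_points D = p ` {0, 1, 2} \<and>
        (\<forall>i \<in> {0, 1, 2}. \<forall>t. curve D t = p i \<longrightarrow> mark D t = Virt i))"
    using crossing_points_MK1 by (intro bexI[OF _ mem]) simp
  \<comment> \<open>The counterexample is \<open>K1\<close>, with T = {1, 2}.\<close>
  moreover have "\<not> (\<forall>T. finite T \<and> 0 \<notin> T \<longrightarrow>
        (\<forall>K \<in> mv_knots T. trivial_knot (M_knot T K)))"
    using K1 nontrivial by (intro notI) (auto dest: spec[of _ "{1, 2 :: nat}"])
  ultimately show ?thesis using K1 MK1 inv nontrivial by blast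
qed

end
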